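(* Let $\Omega\subset\mathbb{R}^n$ be open, let $p\in(1,\infty)$, let $\omega\in A_p$, and let $\varphi\in\Phi_{\mathrm w}(\Omega)$ satisfy (A0), (A1)$_\omega$, (A2)$_\omega$ and (aInc)$_p$. Then there is a constant $C$ such that for all $f\in L^\varphi(\Omega,\omega)$, \[\|Mf\|_{L^\varphi(\Omega,\omega)}\le C\,\|f\|_{L^\varphi(\Omega,\omega)}.\]
   Context: $\Omega\subset\mathbb{R}^n$ is open with Lebesgue measure; balls $B$ are open balls in $\mathbb{R}^n$. A weight is a nonnegative locally integrable function $\omega$ on $\mathbb{R}^n$, and $\omega(E):=\int_E\omega\,dx$. $L^1(\Omega,\omega)$ is the set of measurable $h$ with $\int_\Omega|h|\omega\,dx<\infty$. For $p>0$, a function $\varphi:\Omega\times[0,\infty)\to[0,\infty]$ satisfies (aInc)$_p$ if there is $a\ge1$ with $\varphi(x,s)/s^p\le a\,\varphi(x,t)/t^p$ for all $0<s<t$ and a.e. $x$. $\varphi:\Omega\times[0,\infty)\to[0,\infty]$ is a $\Phi$-prefunction if $x\mapsto\varphi(x,|f(x)|)$ is measurable for every measurable $f$, and for a.e. $x$ the map $t\mapsto\varphi(x,t)$ is increasing with $\varphi(x,0)=\lim_{t\to0^+}\varphi(x,t)=0$ and $\lim_{t\to\infty}\varphi(x,t)=\infty$. $\Phi_{\mathrm w}(\Omega)$ is the set of $\Phi$-prefunctions satisfying (aInc)$_1$. Conditions for $\varphi\in\Phi_{\mathrm w}(\Omega)$: (A0): there is $\beta_0\in(0,1]$ with $\varphi(x,\beta_0)\le1\le\varphi(x,1/\beta_0)$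 for a.e. $x\in\Omega$. (A1)$_\omega$: there is $\beta_1\in(0,1]$ such that $\varphi(x,\beta_1t)\le\varphi(y,t)$ for every ball $B$ with $\omega(B)\le1$, a.e. $x,y\in B\cap\Omega$, and every $t\ge0$ with $\varphi(y,t)\in[1,1/\omega(B)]$. (A2)$_\omega$: for every $s>0$ there exist $\beta_2\in(0,1]$ and $h\in L^1(\Omega,\omega)\cap L^\infty(\Omega)$, $h\ge0$, such that $\varphi(x,\beta_2t)\le\varphi(y,t)+h(x)+h(y)$ for a.e. $x,y\in\Omega$ whenever $\varphi(y,t)\in[0,s]$. Weighted modular $\varrho^\omega_\varphi(f):=\int_\Omega\varphi(x,|f(x)|)\omega(x)\,dx$; norm $\|f\|_{L^\varphi(\Omega,\omega)}:=\inf\{\lambda>0:\varrho^\omega_\varphi(f/\lambda)\le1\}$; $L^\varphi(\Omega,\omega)$ is the set of measurable $f$ with finite norm. Maximal operator: $Mf(x)=\sup_{B\ni x}\frac1{|B|}\int_{B\cap\Omega}|f(y)|\,dy$, supremum over open balls containing $x$. For $1<q<\infty$, $\omega\in A_q$ means $\sup_B|B|^{-q}\omega(B)\big(\int_B\omega^{-q'/q}dx\big)^{q-1}<\infty$ with $1/q+1/q'=1$, the supremum over all open balls $B\subset\mathbb{R}^n$. *)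

theory Defs
  imports "HOL-Analysis.Analysis"
begin

definition is_weight :: "('a::euclidean_space \<Rightarrow> real) \<Rightarrow> bool" where
  "is_weight \<omega> \<longleftrightarrow> (\<forall>x. 0 \<le> \<omega> x) \<and> (\<forall>K. compact K \<longrightarrow> set_integrable lebesgue K \<omega>)"

definition wmeas :: "('a::euclidean_space \<Rightarrow> real) \<Rightarrow> 'a set \<Rightarrow> ennreal" where
  "wmeas \<omega> E = (\<integral>\<^sup>+ x\<in>E. ennreal (\<omega> x) \<partial>lebesgue)"

text \<open>omega to the power -q'/q = -1/(q-1), with value infinity where omega vanishes.\<close>
definition weight_dual :: "real \<Rightarrow> ('a \<Rightarrow> real) \<Rightarrow> 'a \<Rightarrow> ennreal" where
  "weight_dual q \<omega> x = (if \<omega> x = 0 then \<infinity> else ennreal (\<omega> x powr (- (1 / (q - 1)))))"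

definition Muckenhoupt :: "real \<Rightarrow> ('a::euclidean_space \<Rightarrow> real) \<Rightarrow> bool" where
  "Muckenhoupt q \<omega> \<longleftrightarrow> is_weight \<omega> \<and>
     (\<exists>C. \<forall>c r. r > 0 \<longrightarrow>
        (let B = ball c r; I = (\<integral>\<^sup>+ x\<in>B. weight_dual q \<omega> x \<partial>lebesgue) in
           I < \<infinity> \<and>
           measure lebesgue B powr (- q) * enn2real (wmeas \<omega> B) * enn2real I powr (q - 1) \<le> C))"

definition aInc :: "real \<Rightarrow> 'a::euclidean_space set \<Rightarrow> ('a \<Rightarrow> real \<Rightarrow> ennreal) \<Rightarrow> bool" where
  "aInc p \<Omega> \<phi> \<longleftrightarrow> (\<exists>a\<ge>1. AE x in lebesgue_on \<Omega>. \<forall>s t. 0 < s \<and> s < t \<longrightarrow>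
       \<phi> x s * ennreal (t powr p) \<le> ennreal a * \<phi> x t * ennreal (s powr p))"

definition Phi_prefunction :: "'a::euclidean_space set \<Rightarrow> ('a \<Rightarrow> real \<Rightarrow> ennreal) \<Rightarrow> bool" where
  "Phi_prefunction \<Omega> \<phi> \<longleftrightarrow>
     (\<forall>f \<in> borel_measurable (lebesgue_on \<Omega>). (\<lambda>x. \<phi> x \<bar>f x\<bar>) \<in> borel_measurable (lebesgue_on \<Omega>)) \<and>
     (AE x in lebesgue_on \<Omega>. mono_on {0..} (\<phi> x) \<and> \<phi> x 0 = 0 \<and>
        (\<phi> x \<longlongrightarrow> 0) (at_right 0) \<and> (\<phi> x \<longlongrightarrow> \<infinity>) at_top)"

definition Phi_w :: "'a::euclidean_space set \<Rightarrow> ('a \<Rightarrow> real \<Rightarrow> ennreal) \<Rightarrow> bool" where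
  "Phi_w \<Omega> \<phi> \<longleftrightarrow> Phi_prefunction \<Omega> \<phi> \<and> aInc 1 \<Omega> \<phi>"

definition A0 :: "'a::euclidean_space set \<Rightarrow> ('a \<Rightarrow> real \<Rightarrow> ennreal) \<Rightarrow> bool" where
  "A0 \<Omega> \<phi> \<longleftrightarrow> (\<exists>\<beta>0. 0 < \<beta>0 \<and> \<beta>0 \<le> 1 \<and>
      (AE x in lebesgue_on \<Omega>. \<phi> x \<beta>0 \<le> 1 \<and> 1 \<le> \<phi> x (1 / \<beta>0)))"

definition A1 :: "('a::euclidean_space \<Rightarrow> real) \<Rightarrow> 'a set \<Rightarrow> ('a \<Rightarrow> real \<Rightarrow> ennreal) \<Rightarrow> bool" where
  "A1 \<omega> \<Omega> \<phi> \<longleftrightarrow> (\<exists>\<beta>1. 0 < \<beta>1 \<and> \<beta>1 \<le> 1 \<and>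
     (\<forall>c r. r > 0 \<and> wmeas \<omega> (ball c r) \<le> 1 \<longrightarrow>
        (AE x in lebesgue_on (ball c r \<inter> \<Omega>). AE y in lebesgue_on (ball c r \<inter> \<Omega>).
           \<forall>t\<ge>0. 1 \<le> \<phi> y t \<and> \<phi> y t \<le> 1 / wmeas \<omega> (ball c r) \<longrightarrow> \<phi> x (\<beta>1 * t) \<le> \<phi> y t)))"

definition A2 :: "('a::euclidean_space \<Rightarrow> real) \<Rightarrow> 'a set \<Rightarrow> ('a \<Rightarrow> real \<Rightarrow> ennreal) \<Rightarrow> bool" where
  "A2 \<omega> \<Omega> \<phi> \<longleftrightarrow> (\<forall>s>0. \<exists>\<beta>2 h. 0 < \<beta>2 \<and> \<beta>2 \<le> 1 \<and>
     (\<forall>x. 0 \<le> h x) \<and> h \<in> borel_measurable (lebesgue_on \<Omega>) \<and>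
     (\<integral>\<^sup>+ x\<in>\<Omega>. ennreal (h x * \<omega> x) \<partial>lebesgue) < \<infinity> \<and>
     (\<exists>K. AE x in lebesgue_on \<Omega>. h x \<le> K) \<and>
     (AE x in lebesgue_on \<Omega>. AE y in lebesgue_on \<Omega>.
        \<forall>t\<ge>0. \<phi> y t \<le> ennreal s \<longrightarrow> \<phi> x (\<beta>2 * t) \<le> \<phi> y t + ennreal (h x) + ennreal (h y)))"

text \<open>phi extended to the value infinity (phi(x,infinity) = infinity), applied to
  [0,infinity]-valued functions; for real f one uses g = |f|.\<close>
definition phi_ext :: "('a \<Rightarrow> real \<Rightarrow> ennreal) \<Rightarrow> 'a \<Rightarrow> ennreal \<Rightarrow> ennreal" where
  "phi_ext \<phi> x v = (if v = \<infinity> then \<infinity> else \<phi> x (enn2real v))"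

definition wmodular :: "('a::euclidean_space \<Rightarrow> real \<Rightarrow> ennreal) \<Rightarrow> ('a \<Rightarrow> real) \<Rightarrow> 'a set \<Rightarrow> ('a \<Rightarrow> ennreal) \<Rightarrow> ennreal" where
  "wmodular \<phi> \<omega> \<Omega> g = (\<integral>\<^sup>+ x\<in>\<Omega>. phi_ext \<phi> x (g x) * ennreal (\<omega> x) \<partial>lebesgue)"

definition Lphi_norm :: "('a::euclidean_space \<Rightarrow> real \<Rightarrow> ennreal) \<Rightarrow> ('a \<Rightarrow> real) \<Rightarrow> 'a set \<Rightarrow> ('a \<Rightarrow> ennreal) \<Rightarrow> ennreal" where
  "Lphi_norm \<phi> \<omega> \<Omega> g = Inf {ennreal l | l. l > 0 \<and> wmodular \<phi> \<omega> \<Omega> (\<lambda>x. g x / ennreal l) \<le> 1}"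

text \<open>Maximal function (with values in [0,infinity]); f is zero-extended outside Omega.\<close>
definition maximal :: "'a::euclidean_space set \<Rightarrow> ('a \<Rightarrow> real) \<Rightarrow> 'a \<Rightarrow> ennreal" where
  "maximal \<Omega> f x = (SUP (c, r) \<in> {(c, r). r > 0 \<and> x \<in> ball c r}.
      (\<integral>\<^sup>+ y\<in>ball c r \<inter> \<Omega>. ennreal \<bar>f y\<bar> \<partial>lebesgue) / emeasure lebesgue (ball c r))"

end

theory Submission
  imports Defs
begin

text \<open>
  The weighted \<open>L\<^sup>p\<close> bound for the maximal operator is obtained without reverse Hoelder
  inequalities. Put \<open>\<sigma> = \<omega> powr (- 1 / (p - 1))\<close>. Both \<open>\<omega>\<close> and \<open>\<sigma>\<close> are doubling, so the maximal
  operators \<open>M\<^sub>\<omega>\<close> and \<open>M\<^sub>\<sigma>\<close> are bounded on \<open>L\<^sup>q\<close> of their own measure for \<open>q > 1\<close>, by Vitali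
  covering and a dyadic decomposition; and \<open>(M f) powr (p - 1)\<close> is at most a constant times
  \<open>M\<^sub>\<omega> (M\<^sub>\<sigma> (f / \<sigma>) powr (p - 1) / \<omega>)\<close> (Lerner).

  Let the modular of \<open>g\<close> be at most 1. Up to constants, \<open>\<phi> (x, M g)\<close> is dominated by
  \<open>(M u) powr p + h + (M (h powr (1 / p))) powr p\<close> with \<open>u = \<phi> (\<cdot>, |g|) powr (1 / p)\<close>, and the weighted
  bound applies to \<open>u\<close> and \<open>h powr (1 / p)\<close>. To see the domination on a ball \<open>B\<close>, split \<open>g\<close> at height
  \<open>1 / \<beta>\<^sub>0\<close>. For the small part, (A2) transfers \<open>\<phi> (y, g y)\<close> to the fixed point \<open>x\<close>, where (aInc) replaces
  Jensen's inequality. For the large part with average \<open>A\<close>, (aInc) yields a point \<open>y\<close> of \<open>B\<close> where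
  \<open>\<phi> (y, A / 2)\<close> is at most a constant times the p-th power of the average of \<open>u\<close>; by the weighted
  bound this is at most a constant over \<open>\<omega> B\<close>, so that (A1) applies after shrinking \<open>A\<close>.
\<close>

section \<open>Real powers of extended nonnegative reals\<close>

text \<open>The exponent is \<open>p\<close> throughout: by (aInc) the quotient of
  \<open>\<phi> (x, t) powr (1 / p)\<close> and \<open>t\<close> is increasing up to a constant, so
  the weighted bound for \<open>u\<close> is needed exactly at \<open>p\<close> and no smaller
  exponent has to be reached. Several obstacles shape the argument. (A1) speaks only of values in
  \<open>[1, 1 / \<omega> B]\<close>, and (A2) is used only for values at most 1; hence the
  splitting at \<open>1 / \<beta>\<^sub>0\<close>. The upper end \<open>1 / \<omega> B\<close> can
  be met because a modular at most 1 bounds the weighted integral of \<open>(M u) powr p\<close>.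
  The error \<open>h\<close> of (A2) does not scale with \<open>g\<close>, so every estimate is made
  for modular at most 1 and homogeneity is used only for the norm. The exceptional null sets in (A1)
  depend on the ball, which forces a reduction to countably many balls, at the price of a factor 2
  to the dimension. As \<open>\<phi> (x, \<cdot>)\<close> may jump, passing from averages to their
  supremum costs another factor 2. Both factors are absorbed into the argument of
  \<open>\<phi>\<close>, and (aInc) finally turns the constant in front of the modular into one in
  the argument as well.\<close>

definition epowr :: "ennreal \<Rightarrow> real \<Rightarrow> ennreal" where
  "epowr x r = (if x = top then top else ennreal (enn2real x powr r))"

lemma epowr_ennreal: "0 \<le> x \<Longrightarrow> epowr (ennreal x) r = ennreal (x powr r)"
  by (simp add: epowr_def)

lemma epowr_top [simp]: "epowr top r = top"
  by (simp add: epowr_def)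

lemma epowr_0 [simp]: "epowr 0 r = 0"
  by (simp add: epowr_def)

lemma epowr_eq_top_iff [simp]: "epowr x r = top \<longleftrightarrow> x = top"
  by (simp add: epowr_def)

lemma epowr_eq_0_iff [simp]: "epowr x r = 0 \<longleftrightarrow> x = 0"
  by (cases x) (auto simp: epowr_ennreal)

lemma epowr_mono: "0 \<le> r \<Longrightarrow> x \<le> y \<Longrightarrow> epowr x r \<le> epowr y r"
  by (auto simp: epowr_def top_unique less_top[symmetric] intro!: ennreal_leI powr_mono2 enn2real_mono)

text \<open>No side conditions arise here or in \<open>epowr_epowr\<close> and
  \<open>epowr_add\<close>: \<open>0 powr r = 0\<close> for every \<open>r\<close>, so that
  \<open>epowr\<close> fixes 0 and \<open>top\<close> at every exponent, negative ones included, and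
  \<open>0 * top = 0\<close> is consistent with this.\<close>

lemma epowr_mult: "epowr (x * y) r = epowr x r * epowr y r"
proof (cases "x = top \<or> y = top")
  case True
  then show ?thesis by (auto simp: ennreal_mult_top ennreal_top_mult)
next
  case False
  then obtain a b where "x = ennreal a" "y = ennreal b" "0 \<le> a" "0 \<le> b"
    by (metis ennreal_cases)
  then show ?thesis by (simp add: epowr_ennreal powr_mult flip: ennreal_mult)
qed

lemma epowr_epowr: "epowr (epowr x r) s = epowr x (r * s)"
  by (cases x) (auto simp: epowr_ennreal powr_powr)

lemma epowr_1 [simp]: "epowr x 1 = x"
  by (cases x) (auto simp: epowr_ennreal)

lemma epowr_add: "epowr x (r + s) = epowr x r * epowr x s"
  by (cases x) (simp_all add: epowr_ennreal powr_add flip: ennreal_mult)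

lemma borel_measurable_epowr [measurable (raw)]:
  assumes [measurable]: "f \<in> borel_measurable M"
  shows "(\<lambda>x. epowr (f x) r) \<in> borel_measurable M"
  unfolding epowr_def by measurable

text \<open>Bounding \<open>x + y\<close> by twice the maximum works for every positive exponent, so
  the inequality serves both for \<open>p\<close> and for \<open>1 / p\<close>.\<close>

lemma epowr_add_le:
  assumes "0 < r"
  shows "epowr (x + y) r \<le> ennreal (2 powr r) * (epowr x r + epowr y r)"
proof -
  have "epowr (x + y) r \<le> epowr (2 * max x y) r"
    using assms by (intro epowr_mono) (auto simp: max_def mult_2 add_mono)
  also have "\<dots> = ennreal (2 powr r) * epowr (max x y) r"
    using epowr_ennreal[of 2 r] by (simp add: epowr_mult)
  also have "epowr (max x y) r \<le> epowr x r + epowr y r"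
    by (auto simp: max_def)
  finally show ?thesis by (simp add: mult_left_mono)
qed

section \<open>Maximal operators of doubling measures\<close>

text \<open>The measure is a parameter: Lebesgue measure gives the operator of the theorem, the
  measures of \<open>\<omega>\<close> and of its dual give the two auxiliary operators.\<close>

definition maxop :: "'a::euclidean_space measure \<Rightarrow> ('a \<Rightarrow> ennreal) \<Rightarrow> 'a \<Rightarrow> ennreal" where
  "maxop M f x = (SUP (c, r) \<in> {(c, r). 0 < r \<and> x \<in> ball c r}.
      (\<integral>\<^sup>+ y\<in>ball c r. f y \<partial>M) / emeasure M (ball c r))"

lemma maxop_upper:
  "0 < r \<Longrightarrow> x \<in> ball c r \<Longrightarrow> (\<integral>\<^sup>+ y\<in>ball c r. f y \<partial>M) / emeasure M (ball c r) \<le> maxop M f x"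
  unfolding maxop_def by (rule SUP_upper2[of "(c, r)"]) auto

lemma less_maxop_iff:
  "t < maxop M f x \<longleftrightarrow>
    (\<exists>c r. 0 < r \<and> x \<in> ball c r \<and> t < (\<integral>\<^sup>+ y\<in>ball c r. f y \<partial>M) / emeasure M (ball c r))"
  unfolding maxop_def less_SUP_iff by auto

lemma maxop_least:
  "(\<And>c r. 0 < r \<Longrightarrow> x \<in> ball c r \<Longrightarrow> (\<integral>\<^sup>+ y\<in>ball c r. f y \<partial>M) / emeasure M (ball c r) \<le> t)
    \<Longrightarrow> maxop M f x \<le> t"
  unfolding maxop_def by (rule SUP_least) auto

text \<open>The balls are uncentred, so a ball whose average exceeds \<open>t\<close> lies entirely
  inside the level set.\<close>

lemma open_less_maxop: "open {x. t < maxop M f x}"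
proof -
  have "{x. t < maxop M f x} =
    (\<Union>(c, r)\<in>{(c, r). 0 < r \<and> t < (\<integral>\<^sup>+ y\<in>ball c r. f y \<partial>M) / emeasure M (ball c r)}. ball c r)"
    unfolding less_maxop_iff by (force simp del: mem_ball)
  then show ?thesis by auto
qed

text \<open>Openness of the level sets is all that enters, so the averages may be formed in a
  measure \<open>N\<close> different from \<open>M\<close>.\<close>

lemma borel_measurable_maxop [measurable]:
  assumes "sets M = sets lebesgue"
  shows "maxop N f \<in> borel_measurable M"
proof (rule borel_measurableI_greater)
  have "space M = UNIV" using sets_eq_imp_space_eq[OF assms] by simp
  then show "{x \<in> space M. t < maxop N f x} \<in> sets M" for t
    using open_less_maxop[of t N f] assms by (auto intro: lebesgue_openin)
qed

text \<open>The dilation 5 is that of the Vitali covering lemma. Positivity and finiteness on balls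
  are included so that averages can be multiplied out.\<close>

definition doubling :: "real \<Rightarrow> 'a::euclidean_space measure \<Rightarrow> bool" where
  "doubling D M \<longleftrightarrow> sets M = sets lebesgue \<and>
    (\<forall>c r. 0 < r \<longrightarrow> 0 < emeasure M (ball c r) \<and> emeasure M (ball c r) < top \<and>
      emeasure M (ball c (5 * r)) \<le> ennreal D * emeasure M (ball c r))"

text \<open>Vitali selects countably many disjoint balls whose fivefold dilations cover the union;
  doubling returns to the selected balls, and disjointness adds up their integrals of
  \<open>f\<close>. The common bound \<open>R\<close> on the radii is what the covering lemma
  requires.\<close>

lemma emeasure_Union_ball_le:
  assumes D: "doubling D M" and f [measurable]: "f \<in> borel_measurable M"
    and K: "\<And>c r. (c, r) \<in> K \<Longrightarrow> 0 < r \<and> r \<le> R \<and> t * emeasure M (ball c r) \<le> (\<integral>\<^sup>+ y\<in>ball c r. f y \<partial>M)"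
  shows "t * emeasure M (\<Union>(c, r)\<in>K. ball c r) \<le> ennreal D * (\<integral>\<^sup>+ y. f y \<partial>M)"
proof -
  have sets: "sets M = sets lebesgue" using D by (simp add: doubling_def)
  have op [measurable]: "open S \<Longrightarrow> S \<in> sets M" for S
    by (simp add: sets)
  obtain C where C: "countable C" "C \<subseteq> K"
     "pairwise (\<lambda>i j. disjnt (ball (fst i) (snd i)) (ball (fst j) (snd j))) C"
     "(\<Union>(c, r)\<in>K. ball c r) \<subseteq> (\<Union>i\<in>C. ball (fst i) (5 * snd i))"
    using Vitali_covering_lemma_balls[where S = "\<Union>(c, r)\<in>K. ball c r" and K = K and a = fst and r = snd and B = R] K
    by (metis (no_types, lifting) case_prod_beta prod.collapse subset_refl SUP_cong)
  have CK: "0 < snd i \<and> t * emeasure M (ball (fst i) (snd i)) \<le> (\<integral>\<^sup>+ y\<in>ball (fst i) (snd i). f y \<partial>M)"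
    if "i \<in> C" for i
    using that C(2) K[of "fst i" "snd i"] by auto
  have dj: "disjoint_family_on (\<lambda>i. ball (fst i) (snd i)) C"
    using C(3) by (auto simp: disjoint_family_on_def pairwise_def disjnt_def)
  have "emeasure M (\<Union>(c, r)\<in>K. ball c r) \<le> emeasure M (\<Union>i\<in>C. ball (fst i) (5 * snd i))"
    using C(4) by (intro emeasure_mono op) auto
  also have "\<dots> = (\<integral>\<^sup>+ x. indicator (\<Union>i\<in>C. ball (fst i) (5 * snd i)) x \<partial>M)"
    by (rule nn_integral_indicator[symmetric]) (auto intro!: op)
  \<comment> \<open>Countable subadditivity through Tonelli: the indicator of the union is at most
    the sum of the indicators, written as an integral over the counting measure of
    \<open>C\<close>.\<close>
  also have "\<dots> \<le> (\<integral>\<^sup>+ x. (\<integral>\<^sup>+ i. indicator (ball (fst i) (5 * snd i)) x \<partial>count_space C) \<partial>M)"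
  proof (rule nn_integral_mono)
    fix x
    show "indicator (\<Union>i\<in>C. ball (fst i) (5 * snd i)) x
        \<le> (\<integral>\<^sup>+ i. indicator (ball (fst i) (5 * snd i)) x \<partial>count_space C)"
    proof (cases "x \<in> (\<Union>i\<in>C. ball (fst i) (5 * snd i))")
      case True
      then obtain i where i: "i \<in> C" "x \<in> ball (fst i) (5 * snd i)" by blast
      have "(1::ennreal) = (\<integral>\<^sup>+ j. indicator {i} j \<partial>count_space C)"
        using i by (subst nn_integral_indicator) auto
      also have "\<dots> \<le> (\<integral>\<^sup>+ i. indicator (ball (fst i) (5 * snd i)) x \<partial>count_space C)"
        using i by (intro nn_integral_mono) (auto simp: indicator_def)
      finally show ?thesis using True by simp
    qed simp
  qed
  also have "\<dots> = (\<integral>\<^sup>+ i. emeasure M (ball (fst i) (5 * snd i)) \<partial>count_space C)"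
    using C(1) by (subst nn_integral_count_space_nn_integral) auto
  also have "\<dots> \<le> (\<integral>\<^sup>+ i. ennreal D * emeasure M (ball (fst i) (snd i)) \<partial>count_space C)"
    using CK D by (intro nn_integral_mono) (simp add: doubling_def)
  also have "\<dots> = ennreal D * (\<integral>\<^sup>+ i. emeasure M (ball (fst i) (snd i)) \<partial>count_space C)"
    by (rule nn_integral_cmult) simp
  finally have "t * emeasure M (\<Union>(c, r)\<in>K. ball c r)
      \<le> t * (ennreal D * (\<integral>\<^sup>+ i. emeasure M (ball (fst i) (snd i)) \<partial>count_space C))"
    by (rule mult_left_mono) simp
  also have "\<dots> = ennreal D * (\<integral>\<^sup>+ i. t * emeasure M (ball (fst i) (snd i)) \<partial>count_space C)"
    by (subst nn_integral_cmult) (auto simp: ac_simps)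
  \<comment> \<open>The measure with density \<open>f\<close> turns the sum of the integrals into
    the measure of a disjoint union.\<close>
  also have "\<dots> \<le> ennreal D * (\<integral>\<^sup>+ i. emeasure (density M f) (ball (fst i) (snd i)) \<partial>count_space C)"
    using CK by (intro mult_left_mono nn_integral_mono) (simp_all add: emeasure_density)
  also have "\<dots> = ennreal D * emeasure (density M f) (\<Union>i\<in>C. ball (fst i) (snd i))"
    using dj C(1) by (subst emeasure_UN_countable) (auto simp: op)
  also have "\<dots> \<le> ennreal D * emeasure (density M f) (space (density M f))"
    by (intro mult_left_mono emeasure_space) auto
  also have "\<dots> = ennreal D * (\<integral>\<^sup>+ y. f y \<partial>M)"
    by (subst emeasure_density) (auto intro!: arg_cong2[where f="(*)"] nn_integral_cong)
  finally show ?thesis .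
qed

lemma less_divide_ennreal_iff:
  fixes a b t :: ennreal
  assumes "0 < b" "b < top"
  shows "t < a / b \<longleftrightarrow> t * b < a"
proof -
  have "a / b * b = a"
    using assms by (simp add: ennreal_divide_times)
  then show ?thesis
    using assms ennreal_mult_strict_right_mono[of t "a / b" b] mult_right_mono[of "a / b" t b]
    by (cases "t < a / b") (auto simp: not_less)
qed

text \<open>The radii occurring in a level set may be unbounded, so the set is exhausted by the
  unions \<open>E n\<close> of balls of radius at most \<open>n\<close>. All of them obey the same
  bound, and continuity from below gives the limit.\<close>

lemma maxop_weak_type:
  assumes D: "doubling D M" and f [measurable]: "f \<in> borel_measurable M"
  shows "t * emeasure M {x. t < maxop M f x} \<le> ennreal D * (\<integral>\<^sup>+ y. f y \<partial>M)"
proof -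
  define K where "K n = {(c, r). 0 < r \<and> r \<le> real n \<and>
    t < (\<integral>\<^sup>+ y\<in>ball c r. f y \<partial>M) / emeasure M (ball c r)}" for n
  define E where "E n = (\<Union>(c, r)\<in>K n. ball c r)" for n
  have sets: "sets M = sets lebesgue"
    using D by (auto simp: doubling_def)
  have "open (E n)" for n
    by (auto simp: E_def)
  then have Es: "range E \<subseteq> sets M" by (auto simp: sets)
  have inc: "incseq E"
    by (force simp: incseq_def E_def K_def)
  have "{x. t < maxop M f x} = (\<Union>n. E n)"
  proof (intro equalityI subsetI)
    fix x assume "x \<in> {x. t < maxop M f x}"
    then obtain c r where cr: "0 < r" "x \<in> ball c r"
      "t < (\<integral>\<^sup>+ y\<in>ball c r. f y \<partial>M) / emeasure M (ball c r)"
      by (auto simp: less_maxop_iff)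
    obtain n where "r \<le> real n" using real_arch_simple by blast
    with cr have "(c, r) \<in> K n" by (auto simp: K_def)
    with cr(2) show "x \<in> (\<Union>n. E n)" unfolding E_def by blast
  next
    fix x assume "x \<in> (\<Union>n. E n)"
    then obtain n c r where "(c, r) \<in> K n" "x \<in> ball c r" unfolding E_def by blast
    then show "x \<in> {x. t < maxop M f x}" unfolding K_def less_maxop_iff by blast
  qed
  then have "t * emeasure M {x. t < maxop M f x} = (SUP n. t * emeasure M (E n))"
    using SUP_emeasure_incseq[OF Es inc] by (simp flip: SUP_mult_left_ennreal)
  also have "\<dots> \<le> ennreal D * (\<integral>\<^sup>+ y. f y \<partial>M)"
  proof (rule SUP_least)
    fix n
    show "t * emeasure M (E n) \<le> ennreal D * (\<integral>\<^sup>+ y. f y \<partial>M)"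
      unfolding E_def
    proof (rule emeasure_Union_ball_le[OF D f, where R = "real n"])
      fix c r assume *: "(c, r) \<in> K n"
      then have "0 < emeasure M (ball c r)" "emeasure M (ball c r) < top"
        using D by (auto simp: K_def doubling_def)
      with * show "0 < r \<and> r \<le> real n \<and> t * emeasure M (ball c r) \<le> (\<integral>\<^sup>+ y\<in>ball c r. f y \<partial>M)"
        by (auto simp: K_def less_divide_ennreal_iff)
    qed
  qed
  finally show ?thesis .
qed

section \<open>Dyadic level sets: from the weak type to the strong type bound\<close>

lemma two_powr_less_iff: "0 < a \<Longrightarrow> 2 powr real_of_int k < a \<longleftrightarrow> k \<le> \<lceil>log 2 a\<rceil> - 1"
  by (subst powr_less_iff) (auto simp: less_ceiling_iff[symmetric])

text \<open>A single term dominates, the one with \<open>F\<close> above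
  \<open>2 powr (k + 1)\<close> and at most \<open>2 powr (k + 2)\<close>. The level is
  \<open>2 powr (k + 1)\<close> and not \<open>2 powr k\<close> because truncation at height
  \<open>s\<close> controls the level set at \<open>2 * s\<close>.\<close>

lemma epowr_le_dyadic_sum:
  assumes "0 < q"
  shows "epowr F q \<le> (\<integral>\<^sup>+ k. ennreal (2 powr ((real_of_int k + 2) * q)) *
    indicator {F. ennreal (2 powr (real_of_int k + 1)) < F} F \<partial>count_space UNIV)"
proof (cases F)
  case (real a)
  show ?thesis
  proof (cases "a = 0")
    case False
    with real have a: "0 < a" by simp
    define k where "k = \<lceil>log 2 a\<rceil> - 2"
    have 1: "2 powr (real_of_int k + 1) < a" and 2: "a \<le> 2 powr (real_of_int k + 2)"
      using two_powr_less_iff[OF a, of "k + 1"] two_powr_less_iff[OF a, of "k + 2"] by (auto simp: k_def)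
    have "epowr F q \<le> ennreal (2 powr ((real_of_int k + 2) * q))"
      using assms a 2 powr_mono2[of q a "2 powr (real_of_int k + 2)"]
      by (auto simp: real epowr_ennreal powr_powr intro!: ennreal_leI)
    also have "\<dots> = ennreal (2 powr ((real_of_int k + 2) * q)) *
        indicator {F. ennreal (2 powr (real_of_int k + 1)) < F} F"
      using 1 real by (simp add: ennreal_less_iff)
    also have "\<dots> \<le> (\<integral>\<^sup>+ k. ennreal (2 powr ((real_of_int k + 2) * q)) *
      indicator {F. ennreal (2 powr (real_of_int k + 1)) < F} F \<partial>count_space UNIV)"
      by (rule nn_integral_ge_point) simp
    finally show ?thesis .
  qed (simp add: real)
next
  case top
  \<comment> \<open>At \<open>F = top\<close> every level is exceeded, and the infinitely many terms
    with \<open>k \<ge> 0\<close> are at least 1.\<close>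
  have "top = (\<integral>\<^sup>+ k. indicator {0..} (k::int) \<partial>count_space UNIV)"
    by (simp add: infinite_Ici)
  also have "\<dots> \<le> (\<integral>\<^sup>+ k. ennreal (2 powr ((real_of_int k + 2) * q)) *
    indicator {F. ennreal (2 powr (real_of_int k + 1)) < F} F \<partial>count_space UNIV)"
    using assms by (intro nn_integral_mono) (auto simp: top indicator_def intro!: ge_one_powr_ge_zero)
  finally show ?thesis by (simp add: top_unique)
qed

text \<open>Only the indices up to the largest \<open>m\<close> with \<open>2 powr m < F\<close>
  contribute: a geometric series of ratio \<open>2 powr (- s)\<close>, read downwards from
  \<open>m\<close>.\<close>

lemma dyadic_sum_le_epowr:
  assumes "0 < s"
  shows "(\<integral>\<^sup>+ k. ennreal (2 powr (real_of_int k * s)) *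
      indicator {F. ennreal (2 powr real_of_int k) < F} F \<partial>count_space UNIV)
    \<le> ennreal (1 / (1 - 2 powr (- s))) * epowr F s"
proof (cases F)
  case (real a)
  have lt1: "2 powr (- s) < 1" using assms by (simp add: powr_less_one)
  show ?thesis
  proof (cases "a = 0")
    case False
    with real have a: "0 < a" by simp
    \<comment> \<open>The ceiling minus one, rather than the floor, because the levels have to be
      exceeded strictly.\<close>
    define m where "m = \<lceil>log 2 a\<rceil> - 1"
    have "(\<integral>\<^sup>+ k. ennreal (2 powr (real_of_int k * s)) *
        indicator {F. ennreal (2 powr real_of_int k) < F} F \<partial>count_space UNIV)
      = (\<integral>\<^sup>+ k. ennreal (2 powr (real_of_int k * s)) * indicator {..m} k \<partial>count_space UNIV)"
      using two_powr_less_iff[OF a] a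
      by (intro nn_integral_cong) (auto simp: indicator_def real m_def ennreal_less_iff)
    also have "\<dots> = (\<integral>\<^sup>+ k. ennreal (2 powr (real_of_int k * s)) \<partial>count_space {..m})"
      by (subst nn_integral_count_space_indicator) auto
    also have "\<dots> = (\<integral>\<^sup>+ n. ennreal (2 powr (real_of_int (m - int n) * s)) \<partial>count_space UNIV)"
      by (rule nn_integral_bij_count_space[symmetric], rule bij_betwI[where g = "\<lambda>k. nat (m - k)"]) auto
    also have "\<dots> = (\<Sum>n. ennreal (2 powr (real_of_int m * s) * (2 powr (- s)) ^ n))"
      unfolding nn_integral_count_space_nat
      by (intro suminf_cong arg_cong[where f = ennreal])
         (simp add: powr_realpow[symmetric] powr_powr powr_add[symmetric] algebra_simps)
    also have "\<dots> = ennreal (2 powr (real_of_int m * s) * (1 / (1 - 2 powr (- s))))"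
      using lt1 by (intro suminf_ennreal_eq sums_mult geometric_sums) auto
    also have "\<dots> \<le> ennreal (1 / (1 - 2 powr (- s))) * epowr F s"
    proof -
      have "2 powr real_of_int m \<le> a"
        using two_powr_less_iff[OF a, of m] by (simp add: m_def)
      then have "2 powr (real_of_int m * s) \<le> a powr s"
        using assms powr_mono2[of s "2 powr real_of_int m" a] by (simp add: powr_powr)
      then show ?thesis
        using a lt1 by (auto simp: real epowr_ennreal ennreal_mult[symmetric] mult.commute
          intro!: ennreal_leI mult_right_mono divide_right_mono)
    qed
    finally show ?thesis .
  qed (simp add: real)
next
  case top
  have "2 powr (- s) < 1" using assms by (simp add: powr_less_one)
  then have "ennreal (1 / (1 - 2 powr (- s))) \<noteq> 0" using assms by simp
  then show ?thesis by (simp add: top)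
qed

text \<open>The values of \<open>f\<close> not above \<open>s\<close> add at most \<open>s\<close>
  to any average, so an average above \<open>2 * s\<close> leaves more than \<open>s\<close> to the
  values above \<open>s\<close>.\<close>

lemma maxop_truncate:
  assumes D: "doubling D M" and f [measurable]: "f \<in> borel_measurable M"
    and "2 * s < maxop M f x"
  shows "s < maxop M (\<lambda>y. f y * indicator {y. s < f y} y) x"
proof -
  have sets: "sets M = sets lebesgue" using D by (auto simp: doubling_def)
  obtain c r where cr: "0 < r" "x \<in> ball c r"
    and *: "2 * s < (\<integral>\<^sup>+ y\<in>ball c r. f y \<partial>M) / emeasure M (ball c r)"
    using assms(3) by (auto simp: less_maxop_iff)
  have [measurable]: "ball c r \<in> sets M" by (simp add: sets)
  have B: "0 < emeasure M (ball c r)" "emeasure M (ball c r) < top"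
    using D cr by (auto simp: doubling_def)
  have "s * emeasure M (ball c r) + s * emeasure M (ball c r) < (\<integral>\<^sup>+ y\<in>ball c r. f y \<partial>M)"
    using * B by (simp add: less_divide_ennreal_iff mult_2 distrib_right)
  also have "\<dots> \<le> (\<integral>\<^sup>+ y. f y * indicator {y. s < f y} y * indicator (ball c r) y
      + s * indicator (ball c r) y \<partial>M)"
    by (intro nn_integral_mono) (auto simp: indicator_def)
  also have "\<dots> = (\<integral>\<^sup>+ y\<in>ball c r. f y * indicator {y. s < f y} y \<partial>M) + s * emeasure M (ball c r)"
    by (subst nn_integral_add) (auto simp: nn_integral_cmult_indicator)
  finally have "s * emeasure M (ball c r) < (\<integral>\<^sup>+ y\<in>ball c r. f y * indicator {y. s < f y} y \<partial>M)"
    by (rule contrapos_pp) (simp add: not_less add_right_mono)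
  then have "s < (\<integral>\<^sup>+ y\<in>ball c r. f y * indicator {y. s < f y} y \<partial>M) / emeasure M (ball c r)"
    using B by (simp add: less_divide_ennreal_iff)
  with cr show ?thesis
    unfolding less_maxop_iff by blast
qed

text \<open>Marcinkiewicz interpolation in dyadic form. The level set at
  \<open>2 powr (k + 1)\<close> is estimated by the weak type bound for the part of \<open>f\<close>
  above \<open>2 powr k\<close>. After exchanging sum and integral, \<open>q > 1\<close> makes the
  sum of \<open>2 powr (k * (q - 1))\<close> over the levels below \<open>f x\<close> geometric,
  hence comparable to \<open>f x\<close> to the power \<open>q - 1\<close>.\<close>

theorem maxop_strong_type:
  assumes D: "doubling D (M :: 'a::euclidean_space measure)" and q: "1 < q"
  obtains K :: real where "0 \<le> K" "\<And>f. f \<in> borel_measurable M \<Longrightarrow>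
    (\<integral>\<^sup>+ x. epowr (maxop M f x) q \<partial>M) \<le> ennreal K * (\<integral>\<^sup>+ x. epowr (f x) q \<partial>M)"
proof
  have sets: "sets M = sets lebesgue" using D by (auto simp: doubling_def)
  let ?G = "1 / (1 - 2 powr (- (q - 1)))"
  \<comment> \<open>\<open>2 powr (2 * q)\<close> is left over from the factors
    \<open>2 powr ((k + 2) * q)\<close>, \<open>\<bar>D\<bar>\<close> is the weak type constant, and
    \<open>?G\<close> sums the geometric series.\<close>
  let ?K = "2 powr (2 * q) * \<bar>D\<bar> * ?G"
  have G: "0 \<le> ?G" using q by (simp add: powr_less_one less_imp_le)
  then show "0 \<le> ?K" by (intro mult_nonneg_nonneg) auto
  fix f :: "'a \<Rightarrow> ennreal" assume f [measurable]: "f \<in> borel_measurable M"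
  note [measurable] = borel_measurable_maxop[OF sets]
  have "(\<integral>\<^sup>+ x. epowr (maxop M f x) q \<partial>M) \<le>
    (\<integral>\<^sup>+ x. (\<integral>\<^sup>+ k. ennreal (2 powr ((real_of_int k + 2) * q)) *
      indicator {F. ennreal (2 powr (real_of_int k + 1)) < F} (maxop M f x) \<partial>count_space UNIV) \<partial>M)"
    using q by (intro nn_integral_mono epowr_le_dyadic_sum) simp
  also have "\<dots> = (\<integral>\<^sup>+ k. (\<integral>\<^sup>+ x. ennreal (2 powr ((real_of_int k + 2) * q)) *
      indicator {F. ennreal (2 powr (real_of_int k + 1)) < F} (maxop M f x) \<partial>M) \<partial>count_space UNIV)"
    by (rule nn_integral_count_space_nn_integral) auto
  also have "\<dots> \<le> (\<integral>\<^sup>+ k. ennreal (2 powr (2 * q) * \<bar>D\<bar>) * (\<integral>\<^sup>+ x. f x * (ennreal (2 powr (real_of_int k * (q - 1))) *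
      indicator {F. ennreal (2 powr real_of_int k) < F} (f x)) \<partial>M) \<partial>count_space UNIV)"
  proof (rule nn_integral_mono)
    fix k :: int
    define s where "s = ennreal (2 powr real_of_int k)"
    have s2: "ennreal (2 powr (real_of_int k + 1)) = 2 * s"
      by (simp add: s_def powr_add mult.commute ennreal_mult')
    let ?fs = "\<lambda>y. f y * indicator {y. s < f y} y"
    have [measurable]: "?fs \<in> borel_measurable M"
      unfolding indicator_def by measurable
    have "(\<integral>\<^sup>+ x. ennreal (2 powr ((real_of_int k + 2) * q)) *
        indicator {F. ennreal (2 powr (real_of_int k + 1)) < F} (maxop M f x) \<partial>M)
      = ennreal (2 powr ((real_of_int k + 2) * q)) * (\<integral>\<^sup>+ x. indicator {x. 2 * s < maxop M f x} x \<partial>M)"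
      unfolding s2 by (subst nn_integral_cmult[symmetric])
        (auto simp: indicator_def intro!: nn_integral_cong)
    also have "\<dots> \<le> ennreal (2 powr ((real_of_int k + 2) * q)) * (\<integral>\<^sup>+ x. indicator {x. s < maxop M ?fs x} x \<partial>M)"
      using maxop_truncate[OF D f] by (intro mult_left_mono nn_integral_mono) (auto simp: indicator_def)
    also have "(\<integral>\<^sup>+ x. indicator {x. s < maxop M ?fs x} x \<partial>M) = emeasure M {x. s < maxop M ?fs x}"
      using open_less_maxop[of s M ?fs] by (intro nn_integral_indicator) (simp add: sets)
    \<comment> \<open>A factor \<open>s\<close> is inserted, and compensated by its inverse, since
      the weak type inequality bounds \<open>s\<close> times the measure.\<close>
    also have "\<dots> = ennreal (2 powr (- real_of_int k)) * (s * emeasure M {x. s < maxop M ?fs x})"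
      by (simp add: s_def mult.assoc[symmetric] ennreal_mult[symmetric] powr_add[symmetric])
    also have "\<dots> \<le> ennreal (2 powr (- real_of_int k)) * (ennreal \<bar>D\<bar> * (\<integral>\<^sup>+ y. ?fs y \<partial>M))"
      by (intro mult_left_mono order_trans[OF maxop_weak_type[OF D]] mult_right_mono) (auto intro: ennreal_leI)
    finally have "(\<integral>\<^sup>+ x. ennreal (2 powr ((real_of_int k + 2) * q)) *
        indicator {F. ennreal (2 powr (real_of_int k + 1)) < F} (maxop M f x) \<partial>M)
      \<le> ennreal (2 powr ((real_of_int k + 2) * q)) * (ennreal (2 powr (- real_of_int k)) * (ennreal \<bar>D\<bar> * (\<integral>\<^sup>+ y. ?fs y \<partial>M)))"
      by (simp add: mult_left_mono)
    also have "\<dots> = ennreal (2 powr ((real_of_int k + 2) * q) * 2 powr (- real_of_int k) * \<bar>D\<bar>) * (\<integral>\<^sup>+ y. ?fs y \<partial>M)"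
      by (simp add: mult.assoc ennreal_mult)
    also have "2 powr ((real_of_int k + 2) * q) * 2 powr (- real_of_int k) * \<bar>D\<bar>
      = 2 powr (2 * q) * \<bar>D\<bar> * 2 powr (real_of_int k * (q - 1))"
      by (simp add: powr_add[symmetric] algebra_simps)
    also have "ennreal (2 powr (2 * q) * \<bar>D\<bar> * 2 powr (real_of_int k * (q - 1))) * (\<integral>\<^sup>+ y. ?fs y \<partial>M)
      = ennreal (2 powr (2 * q) * \<bar>D\<bar>) * (\<integral>\<^sup>+ x. f x * (ennreal (2 powr (real_of_int k * (q - 1))) *
      indicator {F. ennreal (2 powr real_of_int k) < F} (f x)) \<partial>M)"
      by (subst ennreal_mult, simp, simp, subst mult.assoc, subst nn_integral_cmult[symmetric])
         (auto simp: s_def indicator_def mult_ac intro!: nn_integral_cong arg_cong2[where f="(*)"])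
    finally show "(\<integral>\<^sup>+ x. ennreal (2 powr ((real_of_int k + 2) * q)) *
        indicator {F. ennreal (2 powr (real_of_int k + 1)) < F} (maxop M f x) \<partial>M)
      \<le> ennreal (2 powr (2 * q) * \<bar>D\<bar>) * (\<integral>\<^sup>+ x. f x * (ennreal (2 powr (real_of_int k * (q - 1))) *
      indicator {F. ennreal (2 powr real_of_int k) < F} (f x)) \<partial>M)" .
  qed
  also have "\<dots> = ennreal (2 powr (2 * q) * \<bar>D\<bar>) * (\<integral>\<^sup>+ x. (\<integral>\<^sup>+ k. f x * (ennreal (2 powr (real_of_int k * (q - 1))) *
      indicator {F. ennreal (2 powr real_of_int k) < F} (f x)) \<partial>count_space UNIV) \<partial>M)"
    by (subst nn_integral_cmult, simp, subst nn_integral_count_space_nn_integral) auto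
  also have "\<dots> \<le> ennreal (2 powr (2 * q) * \<bar>D\<bar>) * (\<integral>\<^sup>+ x. ennreal ?G * epowr (f x) q \<partial>M)"
  proof (intro mult_left_mono nn_integral_mono)
    fix x
    have "(\<integral>\<^sup>+ k. f x * (ennreal (2 powr (real_of_int k * (q - 1))) *
      indicator {F. ennreal (2 powr real_of_int k) < F} (f x)) \<partial>count_space UNIV)
      = f x * (\<integral>\<^sup>+ k. ennreal (2 powr (real_of_int k * (q - 1))) *
      indicator {F. ennreal (2 powr real_of_int k) < F} (f x) \<partial>count_space UNIV)"
      by (rule nn_integral_cmult) simp
    also have "\<dots> \<le> f x * (ennreal ?G * epowr (f x) (q - 1))"
      using q by (intro mult_left_mono dyadic_sum_le_epowr) auto
    also have "\<dots> = ennreal ?G * epowr (f x) q"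
      using epowr_add[of "f x" 1 "q - 1"] by (simp add: mult_ac)
    finally show "(\<integral>\<^sup>+ k. f x * (ennreal (2 powr (real_of_int k * (q - 1))) *
      indicator {F. ennreal (2 powr real_of_int k) < F} (f x)) \<partial>count_space UNIV)
      \<le> ennreal ?G * epowr (f x) q" .
  qed simp
  also have "\<dots> = ennreal ?K * (\<integral>\<^sup>+ x. epowr (f x) q \<partial>M)"
    using G by (subst nn_integral_cmult, simp, subst ennreal_mult) (simp_all only: mult.assoc abs_ge_zero mult_nonneg_nonneg powr_ge_zero)
  finally show "(\<integral>\<^sup>+ x. epowr (maxop M f x) q \<partial>M) \<le> ennreal ?K * (\<integral>\<^sup>+ x. epowr (f x) q \<partial>M)" .
qed

section \<open>Muckenhoupt weights\<close>

text \<open>Integrability on closed balls around 0 includes measurability of the restrictions, and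
  these are eventually constant at each point.\<close>

lemma borel_measurable_is_weight:
  assumes "is_weight \<omega>"
  shows "\<omega> \<in> borel_measurable lebesgue"
proof (rule borel_measurable_LIMSEQ_real)
  fix n :: nat
  have "set_integrable lebesgue (cball 0 (real n)) \<omega>"
    using assms by (auto simp: is_weight_def)
  then show "(\<lambda>x. indicator (cball 0 (real n)) x * \<omega> x) \<in> borel_measurable lebesgue"
    by (auto simp: set_integrable_def dest: borel_measurable_integrable)
next
  fix x :: 'a
  obtain N where "norm x \<le> real N" using real_arch_simple by blast
  then have "\<forall>\<^sub>F n in sequentially. \<omega> x = indicator (cball 0 (real n)) x * \<omega> x"
    unfolding eventually_sequentially by (intro exI[of _ N]) auto
  then show "(\<lambda>n. indicator (cball 0 (real n)) x * \<omega> x) \<longlonglongrightarrow> \<omega> x"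
    by (rule tendsto_eventually[OF eventually_mono]) simp
qed

lemma borel_measurable_weight_dual:
  assumes [measurable]: "\<omega> \<in> borel_measurable M"
  shows "weight_dual q \<omega> \<in> borel_measurable M"
  unfolding weight_dual_def by measurable

section \<open>The measures of a weight and of its dual; doubling\<close>

abbreviation weight_measure :: "('a::euclidean_space \<Rightarrow> real) \<Rightarrow> 'a measure" where
  "weight_measure \<omega> \<equiv> density lebesgue (\<lambda>x. ennreal (\<omega> x))"

abbreviation dual_measure :: "real \<Rightarrow> ('a::euclidean_space \<Rightarrow> real) \<Rightarrow> 'a measure" where
  "dual_measure p \<omega> \<equiv> density lebesgue (weight_dual p \<omega>)"

lemma emeasure_weight_measure:
  assumes "is_weight \<omega>" "E \<in> sets lebesgue"
  shows "emeasure (weight_measure \<omega>) E = wmeas \<omega> E"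
  using borel_measurable_is_weight[OF assms(1)] assms(2)
  by (simp add: wmeas_def emeasure_density)

lemma wmeas_ball_finite:
  assumes "is_weight \<omega>"
  shows "wmeas \<omega> (ball c r) < top"
proof -
  have "integrable lebesgue (\<lambda>x. indicator (cball c r) x *\<^sub>R \<omega> x)"
    using assms by (auto simp: is_weight_def set_integrable_def)
  then have "(\<integral>\<^sup>+ x. ennreal (norm (indicator (cball c r) x *\<^sub>R \<omega> x)) \<partial>lebesgue) < top"
    by (auto simp: integrable_iff_bounded)
  moreover have "wmeas \<omega> (ball c r) \<le> (\<integral>\<^sup>+ x. ennreal (norm (indicator (cball c r) x *\<^sub>R \<omega> x)) \<partial>lebesgue)"
    unfolding wmeas_def using assms
    by (intro nn_integral_mono) (auto simp: indicator_def is_weight_def)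
  ultimately show ?thesis by (rule le_less_trans[rotated])
qed

lemma emeasure_lebesgue_ball:
  "0 < r \<Longrightarrow> emeasure lebesgue (ball (c::'a::euclidean_space) r) = ennreal (unit_ball_vol (DIM('a)) * r ^ DIM('a))"
  by (simp add: emeasure_ball)

lemma measure_lebesgue_ball:
  "0 < r \<Longrightarrow> measure lebesgue (ball (c::'a::euclidean_space) r) = unit_ball_vol (DIM('a)) * r ^ DIM('a)"
  unfolding measure_def by (subst emeasure_lebesgue_ball) simp_all

lemma lebesgue_ball_pos:
  "0 < r \<Longrightarrow> 0 < measure lebesgue (ball (c::'a::euclidean_space) r)"
  by (simp add: measure_lebesgue_ball)

text \<open>A Young-type inequality that takes the place of Hoelder's: of
  \<open>l * \<omega> x\<close> and its power \<open>- (1 / (p - 1))\<close> one is at least 1. The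
  parameter \<open>l\<close> is chosen only after integration over a ball. Where
  \<open>\<omega>\<close> vanishes, the dual weight is infinite.\<close>

lemma one_le_weight_plus_dual:
  assumes "1 < p" "0 \<le> \<omega> x" "0 < l"
  shows "1 \<le> ennreal l * ennreal (\<omega> x) + ennreal (l powr (- (1 / (p - 1)))) * weight_dual p \<omega> x"
proof (cases "\<omega> x = 0 \<or> 1 \<le> l * \<omega> x")
  case True
  moreover have "1 \<le> ennreal l * ennreal (\<omega> x)" if "1 \<le> l * \<omega> x"
    using that assms by (simp add: ennreal_mult[symmetric])
  ultimately show ?thesis
    using assms by (auto simp: weight_dual_def intro: add_increasing2)
next
  case False
  then have "1 \<le> (l * \<omega> x) powr (- (1 / (p - 1)))"
    using assms powr_mono2'[of "- (1 / (p - 1))" "l * \<omega> x" 1] by auto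
  also have "(l * \<omega> x) powr (- (1 / (p - 1))) = l powr (- (1 / (p - 1))) * \<omega> x powr (- (1 / (p - 1)))"
    using assms by (simp add: powr_mult)
  finally have "1 \<le> ennreal (l powr (- (1 / (p - 1)))) * weight_dual p \<omega> x"
    using False assms by (simp add: weight_dual_def ennreal_mult[symmetric])
  then show ?thesis by (rule add_increasing[OF zero_le])
qed

text \<open>The last estimate reverses the defining bound up to a constant; it is Hoelder's
  inequality on the ball, weakened by a factor \<open>2 powr p\<close>. Together the two compare the
  product of the measures with the volume from both sides, which is what doubling needs. Real-valued
  \<open>measure\<close> is used so that quotients and roots are available.\<close>

lemma Muckenhoupt_estimates:
  fixes \<omega> :: "'a::euclidean_space \<Rightarrow> real"
  assumes A: "Muckenhoupt p \<omega>" and p: "1 < p"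
  obtains C where "0 < C"
    "\<And>c r. 0 < r \<Longrightarrow> emeasure (weight_measure \<omega>) (ball c r) = ennreal (measure (weight_measure \<omega>) (ball c r))"
    "\<And>c r. 0 < r \<Longrightarrow> emeasure (dual_measure p \<omega>) (ball c r) = ennreal (measure (dual_measure p \<omega>) (ball c r))"
    "\<And>c r. 0 < r \<Longrightarrow> 0 < measure (weight_measure \<omega>) (ball c r)"
    "\<And>c r. 0 < r \<Longrightarrow> 0 < measure (dual_measure p \<omega>) (ball c r)"
    "\<And>c r. 0 < r \<Longrightarrow> measure (weight_measure \<omega>) (ball c r) * measure (dual_measure p \<omega>) (ball c r) powr (p - 1)
        \<le> C * measure lebesgue (ball c r) powr p"
    "\<And>c r. 0 < r \<Longrightarrow> (measure lebesgue (ball c r) / 2) powr p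
        \<le> measure (weight_measure \<omega>) (ball c r) * measure (dual_measure p \<omega>) (ball c r) powr (p - 1)"
proof -
  have w: "is_weight \<omega>" using A by (simp add: Muckenhoupt_def)
  have [measurable]: "\<omega> \<in> borel_measurable lebesgue" by (rule borel_measurable_is_weight[OF w])
  have [measurable]: "weight_dual p \<omega> \<in> borel_measurable lebesgue"
    by (rule borel_measurable_weight_dual) simp
  define W where "W c r = measure (weight_measure \<omega>) (ball c r)" for c r
  define S where "S c r = measure (dual_measure p \<omega>) (ball c r)" for c r
  define V where "V c r = measure lebesgue (ball (c::'a) r)" for c r
  have Vpos: "0 < V c r" if "0 < r" for c r
    using that by (simp add: V_def lebesgue_ball_pos)
  have Seq: "emeasure (dual_measure p \<omega>) (ball c r) = (\<integral>\<^sup>+ x\<in>ball c r. weight_dual p \<omega> x \<partial>lebesgue)" for c r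
    by (simp add: emeasure_density)
  have Weq: "emeasure (weight_measure \<omega>) (ball c r) = wmeas \<omega> (ball c r)" for c r
    by (simp add: emeasure_weight_measure[OF w])
  obtain C0 where C0: "\<And>c r. 0 < r \<Longrightarrow> emeasure (dual_measure p \<omega>) (ball c r) < top \<and>
      V c r powr (- p) * W c r * S c r powr (p - 1) \<le> C0"
    using A unfolding Muckenhoupt_def Let_def Seq[symmetric] Weq[symmetric] V_def W_def S_def measure_def[of "density lebesgue _"]
    by auto
  have 1: "emeasure (weight_measure \<omega>) (ball c r) = ennreal (W c r)" for c r
    using wmeas_ball_finite[OF w, of c r] Weq[of c r] by (simp add: W_def measure_def)
  have 2: "emeasure (dual_measure p \<omega>) (ball c r) = ennreal (S c r)" if "0 < r" for c r
    using C0[OF that] by (simp add: S_def measure_def)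
  have 3: "emeasure lebesgue (ball c r) = ennreal (V c r)" if "0 < r" for c r
    unfolding V_def measure_lebesgue_ball[OF that] emeasure_lebesgue_ball[OF that] ..
  have nn: "0 \<le> W c r" "0 \<le> S c r" for c r by (auto simp: W_def S_def)
  have key: "V c r \<le> l * W c r + l powr (- (1 / (p - 1))) * S c r" if "0 < r" "0 < l" for c r l
  proof -
    have [measurable]: "ball c r \<in> sets lebesgue" by simp
    have "ennreal (V c r) = (\<integral>\<^sup>+ x\<in>ball c r. 1 \<partial>lebesgue)"
      unfolding 3[OF that(1), symmetric] by simp
    also have "\<dots> \<le> (\<integral>\<^sup>+ x\<in>ball c r. (ennreal l * ennreal (\<omega> x) + ennreal (l powr (- (1 / (p - 1)))) * weight_dual p \<omega> x) \<partial>lebesgue)"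
      using one_le_weight_plus_dual[OF p _ that(2), of \<omega>] w
      by (intro nn_integral_mono mult_right_mono) (auto simp: is_weight_def)
    also have "\<dots> = ennreal l * (\<integral>\<^sup>+ x\<in>ball c r. ennreal (\<omega> x) \<partial>lebesgue) +
        ennreal (l powr (- (1 / (p - 1)))) * (\<integral>\<^sup>+ x\<in>ball c r. weight_dual p \<omega> x \<partial>lebesgue)"
      by (subst nn_integral_cmult[symmetric], measurable, subst nn_integral_cmult[symmetric], measurable,
          subst nn_integral_add[symmetric], measurable) (simp_all add: distrib_right mult.assoc)
    also have "\<dots> = ennreal (l * W c r + l powr (- (1 / (p - 1))) * S c r)"
      using 1[of c r] 2[OF that(1), of c] that nn[where c=c and r=r]
      by (simp add: Seq Weq wmeas_def ennreal_mult)
    finally show ?thesis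
      using that nn[where c=c and r=r] by (subst (asm) ennreal_le_iff) simp_all
  qed
  have Spos: "0 < S c r" if "0 < r" for c r
  proof (rule ccontr)
    assume "\<not> 0 < S c r"
    then have "S c r = 0" using nn[of c r] by simp
    \<comment> \<open>This value of \<open>l\<close> keeps the first term of \<open>key\<close>
      below half the volume; the added 1 avoids dividing by \<open>W c r\<close>, whose positivity
      is shown only later.\<close>
    then have "V c r \<le> V c r / (2 * (W c r + 1)) * W c r"
      using key[OF that, of "V c r / (2 * (W c r + 1))" c] Vpos[OF that, of c] nn[of c r] by simp
    also have "\<dots> \<le> V c r / 2"
      using Vpos[OF that, of c] nn[of c r] by (simp add: field_simps)
    finally show False using Vpos[OF that, of c] by simp
  qed
  have low: "(V c r / 2) powr p \<le> W c r * S c r powr (p - 1)" if "0 < r" for c r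
  proof -
    \<comment> \<open>Solves \<open>l powr (- (1 / (p - 1))) * S c r = V c r / 2\<close>: the dual
      term takes half of the volume, and \<open>l * W c r\<close> has to supply the other
      half.\<close>
    define l where "l = (V c r / (2 * S c r)) powr (- (p - 1))"
    have q: "0 < V c r / (2 * S c r)" using Vpos[OF that, of c] Spos[OF that, of c] by simp
    have e: "- (p - 1) * - (1 / (p - 1)) = 1" using p by (simp add: field_simps)
    have l: "0 < l" "l powr (- (1 / (p - 1))) = V c r / (2 * S c r)"
      using q unfolding l_def powr_powr e by (auto simp only: powr_one powr_gt_zero)
    have "V c r / 2 \<le> l * W c r"
      using key[OF that l(1), of c] Spos[OF that, of c] by (simp add: l(2))
    also have "l = (V c r / 2) powr (- (p - 1)) * S c r powr (p - 1)"
      using Vpos[OF that, of c] Spos[OF that, of c]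
      by (simp add: l_def powr_divide powr_mult powr_minus[of _ "p - 1"] del: minus_diff_eq)
    finally have "(V c r / 2) powr (p - 1) * (V c r / 2)
        \<le> (V c r / 2) powr (p - 1) * ((V c r / 2) powr (- (p - 1)) * S c r powr (p - 1) * W c r)"
      by (rule mult_left_mono) simp
    also have "\<dots> = W c r * S c r powr (p - 1)"
      using Vpos[OF that, of c] by (simp add: powr_add[symmetric] mult.assoc[symmetric])
    also have "(V c r / 2) powr (p - 1) * (V c r / 2) = (V c r / 2) powr p"
      using Vpos[OF that, of c] powr_add[of "V c r / 2" "p - 1" 1] by simp
    finally show ?thesis .
  qed
  have Wpos: "0 < W c r" if "0 < r" for c r
  proof (rule ccontr)
    assume "\<not> 0 < W c r"
    then have "W c r = 0" using nn[of c r] by simp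
    with low[OF that, of c] Vpos[OF that, of c] show False by simp
  qed
  \<comment> \<open>The bound obtained from the definition is just some real number; the maximum
    with 1 makes it positive.\<close>
  have up: "W c r * S c r powr (p - 1) \<le> max C0 1 * V c r powr p" if "0 < r" for c r
  proof -
    have "V c r powr (- p) * W c r * S c r powr (p - 1) \<le> max C0 1"
      using C0[OF that, of c] by (meson max.coboundedI1)
    then have "V c r powr p * (V c r powr (- p) * W c r * S c r powr (p - 1)) \<le> V c r powr p * max C0 1"
      by (rule mult_left_mono) simp
    moreover have "V c r powr p * (V c r powr (- p) * W c r * S c r powr (p - 1)) = W c r * S c r powr (p - 1)"
      using Vpos[OF that, of c] by (simp add: powr_minus)
    ultimately show ?thesis by (simp only: mult.commute)
  qed
  show ?thesis
    by (rule that[of "max C0 1"])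
       (use 1 2 Wpos Spos up low in \<open>auto simp: W_def S_def V_def\<close>)
qed

text \<open>The product of \<open>\<omega> B\<close> and the power \<open>p - 1\<close> of
  \<open>\<sigma> B\<close> is comparable to the \<open>p\<close>-th power of the volume, which is
  doubling; so is the product. Both factors grow under dilation, hence either can be cancelled.
  Cancelling \<open>\<omega>\<close> leaves a power \<open>p - 1\<close>, whose root is the second
  entry of \<open>D\<close>.\<close>

lemma Muckenhoupt_doubling:
  fixes \<omega> :: "'a::euclidean_space \<Rightarrow> real"
  assumes A: "Muckenhoupt p \<omega>" and p: "1 < p"
  obtains D where "doubling D (weight_measure \<omega>)" "doubling D (dual_measure p \<omega>)"
proof -
  obtain C where C: "0 < C"
    "\<And>c r. 0 < r \<Longrightarrow> emeasure (weight_measure \<omega>) (ball c r) = ennreal (measure (weight_measure \<omega>) (ball c r))"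
    "\<And>c r. 0 < r \<Longrightarrow> emeasure (dual_measure p \<omega>) (ball c r) = ennreal (measure (dual_measure p \<omega>) (ball c r))"
    "\<And>c r. 0 < r \<Longrightarrow> 0 < measure (weight_measure \<omega>) (ball c r)"
    "\<And>c r. 0 < r \<Longrightarrow> 0 < measure (dual_measure p \<omega>) (ball c r)"
    "\<And>c r. 0 < r \<Longrightarrow> measure (weight_measure \<omega>) (ball c r) * measure (dual_measure p \<omega>) (ball c r) powr (p - 1)
        \<le> C * measure lebesgue (ball c r) powr p"
    "\<And>c r. 0 < r \<Longrightarrow> (measure lebesgue (ball c r) / 2) powr p
        \<le> measure (weight_measure \<omega>) (ball c r) * measure (dual_measure p \<omega>) (ball c r) powr (p - 1)"
    by (rule Muckenhoupt_estimates[OF A p]) blast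
  \<comment> \<open>The volume of the dilated ball is \<open>5 ^ DIM('a) * 2\<close> times half the
    volume of the ball, the half being that of the lower estimate.\<close>
  define E where "E = C * (5 ^ DIM('a) * 2) powr p"
  have E: "0 < E" using C(1) by (simp add: E_def)
  define D where "D = max E (E powr (1 / (p - 1)))"
  have mono: "measure N (ball c r) \<le> measure N (ball c (5 * r))"
    if "0 < r" "emeasure N (ball c (5 * r)) = ennreal (measure N (ball c (5 * r)))" "sets N = sets lebesgue"
    for N :: "'a measure" and c r
  proof (rule measure_mono_fmeasurable)
    show "ball c r \<subseteq> ball c (5 * r)" using that by auto
    show "ball c (5 * r) \<in> fmeasurable N" "ball c r \<in> sets N"
      using that by (auto simp: fmeasurable_def less_top[symmetric])
  qed
  have *: "measure (weight_measure \<omega>) (ball c (5 * r)) \<le> D * measure (weight_measure \<omega>) (ball c r)"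
    "measure (dual_measure p \<omega>) (ball c (5 * r)) \<le> D * measure (dual_measure p \<omega>) (ball c r)"
    if r: "0 < r" for c :: 'a and r
  proof -
    let ?W = "measure (weight_measure \<omega>) (ball c r)" and ?W5 = "measure (weight_measure \<omega>) (ball c (5 * r))"
    let ?S = "measure (dual_measure p \<omega>) (ball c r)" and ?S5 = "measure (dual_measure p \<omega>) (ball c (5 * r))"
    let ?V = "measure lebesgue (ball c r)" and ?V5 = "measure lebesgue (ball c (5 * r))"
    have r5: "0 < 5 * r" using r by simp
    have pos: "0 < ?W" "0 < ?W5" "0 < ?S" "0 < ?S5" "0 < ?V"
      using C(4,5)[OF r] C(4,5)[OF r5] lebesgue_ball_pos[OF r] by auto
    have le: "?W \<le> ?W5" "?S \<le> ?S5"
      using mono[OF r C(2)[OF r5]] mono[OF r C(3)[OF r5]] by auto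
    have V5: "?V5 = (5 ^ DIM('a) * 2) * (?V / 2)"
      unfolding measure_lebesgue_ball[OF r] measure_lebesgue_ball[OF r5] by (simp add: power_mult_distrib)
    have main: "?W5 * ?S5 powr (p - 1) \<le> E * (?W * ?S powr (p - 1))"
    proof -
      have "?W5 * ?S5 powr (p - 1) \<le> C * ?V5 powr p" by (rule C(6)[OF r5])
      also have "\<dots> = E * (?V / 2) powr p"
        unfolding V5 E_def using pos by (subst powr_mult) auto
      also have "\<dots> \<le> E * (?W * ?S powr (p - 1))"
        using E C(7)[OF r, of c] by simp
      finally show ?thesis .
    qed
    have "?W5 * ?S powr (p - 1) \<le> ?W5 * ?S5 powr (p - 1)"
      using pos le p by (intro mult_left_mono powr_mono2) auto
    then have "?W5 * ?S powr (p - 1) \<le> E * ?W * ?S powr (p - 1)"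
      using main by (simp add: mult.assoc)
    then have "?W5 \<le> E * ?W" using pos by simp
    also have "\<dots> \<le> D * ?W" using pos by (simp add: D_def)
    finally show "?W5 \<le> D * ?W" .
    have "?W * ?S5 powr (p - 1) \<le> ?W5 * ?S5 powr (p - 1)"
      using le by (intro mult_right_mono) auto
    then have "?W * ?S5 powr (p - 1) \<le> ?W * (E * ?S powr (p - 1))"
      using main by (simp add: mult_ac)
    then have "?S5 powr (p - 1) \<le> E * ?S powr (p - 1)" using pos by simp
    then have "(?S5 powr (p - 1)) powr (1 / (p - 1)) \<le> (E * ?S powr (p - 1)) powr (1 / (p - 1))"
      using p by (intro powr_mono2) auto
    then have "?S5 \<le> E powr (1 / (p - 1)) * ?S"
      using p pos E by (simp add: powr_powr powr_mult)
    also have "\<dots> \<le> D * ?S" using pos by (simp add: D_def)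
    finally show "?S5 \<le> D * ?S" .
  qed
  have "0 < D" using E by (simp add: D_def)
  have d: "doubling D N" if N: "sets N = sets lebesgue"
    "\<And>c r. 0 < r \<Longrightarrow> emeasure N (ball c r) = ennreal (measure N (ball c r))"
    "\<And>c r. 0 < r \<Longrightarrow> 0 < measure N (ball c r)"
    "\<And>c r. 0 < r \<Longrightarrow> measure N (ball c (5 * r)) \<le> D * measure N (ball c r)" for N :: "'a measure"
    unfolding doubling_def
  proof (intro conjI allI impI)
    fix c :: 'a and r :: real assume r: "0 < r"
    then have r5: "0 < 5 * r" by simp
    show "0 < emeasure N (ball c r)" "emeasure N (ball c r) < top"
      using N(2,3)[OF r] by auto
    show "emeasure N (ball c (5 * r)) \<le> ennreal D * emeasure N (ball c r)"
      unfolding N(2)[OF r] N(2)[OF r5] using N(4)[OF r, of c] \<open>0 < D\<close>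
      by (simp add: ennreal_mult[symmetric] ennreal_leI)
  qed (rule N(1))
  show ?thesis
    by (rule that; rule d) (use C * in auto)
qed

text \<open>The dual weight is infinite where \<open>\<omega>\<close> vanishes, yet its integral
  over every ball is finite.\<close>

lemma Muckenhoupt_AE_pos:
  fixes \<omega> :: "'a::euclidean_space \<Rightarrow> real"
  assumes A: "Muckenhoupt p \<omega>"
  shows "AE x in lebesgue. 0 < \<omega> x"
proof -
  have w: "is_weight \<omega>" using A by (simp add: Muckenhoupt_def)
  have [measurable]: "\<omega> \<in> borel_measurable lebesgue" by (rule borel_measurable_is_weight[OF w])
  have [measurable]: "weight_dual p \<omega> \<in> borel_measurable lebesgue"
    by (rule borel_measurable_weight_dual) simp
  have "AE x in lebesgue. x \<in> ball 0 (real (Suc n)) \<longrightarrow> 0 < \<omega> x" for n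
  proof -
    have [measurable]: "ball (0::'a) (real (Suc n)) \<in> sets lebesgue" by simp
    have "(\<integral>\<^sup>+ x\<in>ball 0 (real (Suc n)). weight_dual p \<omega> x \<partial>lebesgue) \<noteq> \<infinity>"
      using A unfolding Muckenhoupt_def Let_def by (metis less_irrefl of_nat_0_less_iff zero_less_Suc)
    then have "AE x in lebesgue. weight_dual p \<omega> x * indicator (ball 0 (real (Suc n))) x \<noteq> \<infinity>"
      by (intro nn_integral_PInf_AE) measurable
    then show ?thesis
      by eventually_elim (use w in \<open>auto simp: weight_dual_def is_weight_def order_less_le\<close>)
  qed
  then have "AE x in lebesgue. \<forall>n. x \<in> ball 0 (real (Suc n)) \<longrightarrow> 0 < \<omega> x"
    by (intro AE_all_countable[THEN iffD2] allI)
  then show ?thesis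
  proof eventually_elim
    case (elim x)
    obtain n where "norm x < real n" using reals_Archimedean2 by blast
    then have "x \<in> ball 0 (real (Suc n))" by simp
    with elim show ?case by blast
  qed
qed

section \<open>The weighted bound through the two auxiliary maximal operators\<close>

lemma ennreal_mult_divide_self:
  fixes a b :: ennreal
  assumes "0 < b" "b < top"
  shows "b * (a / b) = a"
  using assms by (simp add: ennreal_times_divide mult.commute[of b] ennreal_mult_divide_eq)

text \<open>On a ball containing \<open>x\<close>, with \<open>b\<close> the integral of
  \<open>f\<close> and \<open>V\<close>, \<open>W\<close>, \<open>S\<close> the three measures of
  the ball, \<open>F \<ge> b / S\<close>, because the \<open>\<sigma>\<close>-integral of
  \<open>f / \<sigma>\<close> is \<open>b\<close>. Hence \<open>V\<close> times the power
  \<open>p - 1\<close> of \<open>b / S\<close> is at most the integral of the same power of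
  \<open>F\<close>. This is an \<open>\<omega>\<close>-integral after division by
  \<open>\<omega>\<close>, so it is at most \<open>W * G x\<close>. The Muckenhoupt bound trades the
  power \<open>p - 1\<close> of \<open>S / V\<close> for \<open>C * V / W\<close>.\<close>

lemma maxop_le_maxop_maxop_dual:
  fixes \<omega> :: "'a::euclidean_space \<Rightarrow> real"
  assumes A: "Muckenhoupt p \<omega>" and p: "1 < p"
  obtains C where "0 < C" "\<And>f x. f \<in> borel_measurable lebesgue \<Longrightarrow>
    epowr (maxop lebesgue f x) (p - 1) \<le> ennreal C * maxop (weight_measure \<omega>)
      (\<lambda>y. epowr (maxop (dual_measure p \<omega>) (\<lambda>z. f z / weight_dual p \<omega> z) y) (p - 1) / ennreal (\<omega> y)) x"
proof -
  obtain C where C: "0 < C"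
    "\<And>c r. 0 < r \<Longrightarrow> emeasure (weight_measure \<omega>) (ball c r) = ennreal (measure (weight_measure \<omega>) (ball c r))"
    "\<And>c r. 0 < r \<Longrightarrow> emeasure (dual_measure p \<omega>) (ball c r) = ennreal (measure (dual_measure p \<omega>) (ball c r))"
    "\<And>c r. 0 < r \<Longrightarrow> 0 < measure (weight_measure \<omega>) (ball c r)"
    "\<And>c r. 0 < r \<Longrightarrow> 0 < measure (dual_measure p \<omega>) (ball c r)"
    "\<And>c r. 0 < r \<Longrightarrow> measure (weight_measure \<omega>) (ball c r) * measure (dual_measure p \<omega>) (ball c r) powr (p - 1)
        \<le> C * measure lebesgue (ball c r) powr p"
    "\<And>c r. 0 < r \<Longrightarrow> (measure lebesgue (ball c r) / 2) powr p
        \<le> measure (weight_measure \<omega>) (ball c r) * measure (dual_measure p \<omega>) (ball c r) powr (p - 1)"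
    by (rule Muckenhoupt_estimates[OF A p]) blast
  have w: "is_weight \<omega>" using A by (simp add: Muckenhoupt_def)
  have [measurable]: "\<omega> \<in> borel_measurable lebesgue" by (rule borel_measurable_is_weight[OF w])
  have [measurable]: "weight_dual p \<omega> \<in> borel_measurable lebesgue"
    by (rule borel_measurable_weight_dual) simp
  show ?thesis
  proof (rule that[OF C(1)])
    fix f :: "'a \<Rightarrow> ennreal" and x :: 'a
    assume f [measurable]: "f \<in> borel_measurable lebesgue"
    define F where "F = maxop (dual_measure p \<omega>) (\<lambda>z. f z / weight_dual p \<omega> z)"
    define G where "G = maxop (weight_measure \<omega>) (\<lambda>y. epowr (F y) (p - 1) / ennreal (\<omega> y))"
    have [measurable]: "F \<in> borel_measurable lebesgue"
      unfolding F_def by (rule borel_measurable_maxop) simp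
    have avg: "epowr ((\<integral>\<^sup>+ y\<in>ball c r. f y \<partial>lebesgue) / emeasure lebesgue (ball c r)) (p - 1) \<le> ennreal C * G x"
      if r: "0 < r" and x: "x \<in> ball c r" for c r
    proof -
      define b where "b = (\<integral>\<^sup>+ y\<in>ball c r. f y \<partial>lebesgue)"
      define V where "V = measure lebesgue (ball c r)"
      define W where "W = measure (weight_measure \<omega>) (ball c r)"
      define S where "S = measure (dual_measure p \<omega>) (ball c r)"
      have pos: "0 < V" "0 < W" "0 < S"
        using r C(4,5) by (auto simp: V_def W_def S_def lebesgue_ball_pos)
      have V: "emeasure lebesgue (ball c r) = ennreal V"
        unfolding V_def measure_lebesgue_ball[OF r] emeasure_lebesgue_ball[OF r] ..
      have [measurable]: "ball c r \<in> sets lebesgue" by simp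
      have Fb: "b * ennreal (1 / S) \<le> F y" if "y \<in> ball c r" for y
      proof -
        have "(\<integral>\<^sup>+ z\<in>ball c r. (f z / weight_dual p \<omega> z) \<partial>dual_measure p \<omega>)
            = (\<integral>\<^sup>+ z. weight_dual p \<omega> z * (f z / weight_dual p \<omega> z * indicator (ball c r) z) \<partial>lebesgue)"
          by (rule nn_integral_density) measurable
        also have "\<dots> = b"
          unfolding b_def
        proof (rule nn_integral_cong_AE)
          show "AE z in lebesgue. weight_dual p \<omega> z * (f z / weight_dual p \<omega> z * indicator (ball c r) z)
              = f z * indicator (ball c r) z"
            using Muckenhoupt_AE_pos[OF A]
            by eventually_elim (simp add: mult.assoc[symmetric] ennreal_mult_divide_self weight_dual_def)
        qed
        finally have "b / ennreal S \<le> F y"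
          using maxop_upper[OF r that, where f = "\<lambda>z. f z / weight_dual p \<omega> z" and M = "dual_measure p \<omega>"] C(3)[OF r, of c]
          by (simp add: F_def S_def)
        then show ?thesis
          using pos by (simp add: divide_ennreal_def inverse_ennreal inverse_eq_divide)
      qed
      have "epowr (b * ennreal (1 / S)) (p - 1) * ennreal V
          = (\<integral>\<^sup>+ y\<in>ball c r. epowr (b * ennreal (1 / S)) (p - 1) \<partial>lebesgue)"
        unfolding V[symmetric] by (rule nn_integral_cmult_indicator[symmetric]) simp
      also have "\<dots> \<le> (\<integral>\<^sup>+ y. ennreal (\<omega> y) * (epowr (F y) (p - 1) / ennreal (\<omega> y) * indicator (ball c r) y) \<partial>lebesgue)"
      proof (rule nn_integral_mono_AE)
        show "AE y in lebesgue. epowr (b * ennreal (1 / S)) (p - 1) * indicator (ball c r) y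
          \<le> ennreal (\<omega> y) * (epowr (F y) (p - 1) / ennreal (\<omega> y) * indicator (ball c r) y)"
          using Muckenhoupt_AE_pos[OF A]
        proof eventually_elim
          case (elim y)
          have "ennreal (\<omega> y) * (epowr (F y) (p - 1) / ennreal (\<omega> y) * indicator (ball c r) y)
              = epowr (F y) (p - 1) * indicator (ball c r) y"
            using elim by (simp add: mult.assoc[symmetric] ennreal_mult_divide_self)
          moreover have "epowr (b * ennreal (1 / S)) (p - 1) \<le> epowr (F y) (p - 1)" if "y \<in> ball c r"
            using p by (intro epowr_mono Fb that) simp
          ultimately show ?case by (auto simp: indicator_def)
        qed
      qed
      also have "\<dots> = (\<integral>\<^sup>+ y\<in>ball c r. (epowr (F y) (p - 1) / ennreal (\<omega> y)) \<partial>weight_measure \<omega>)"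
        by (rule nn_integral_density[symmetric]) measurable
      also have "\<dots> \<le> ennreal W * G x"
      proof -
        let ?I = "\<integral>\<^sup>+ y\<in>ball c r. (epowr (F y) (p - 1) / ennreal (\<omega> y)) \<partial>weight_measure \<omega>"
        have "?I / ennreal W \<le> G x"
          using maxop_upper[OF r x, where f = "\<lambda>y. epowr (F y) (p - 1) / ennreal (\<omega> y)" and M = "weight_measure \<omega>"] C(2)[OF r, of c]
          by (simp add: G_def W_def)
        then have "ennreal W * (?I / ennreal W) \<le> ennreal W * G x"
          by (rule mult_left_mono) simp
        then show ?thesis
          using pos by (simp add: ennreal_mult_divide_self)
      qed
      finally have 1: "epowr (b * ennreal (1 / S)) (p - 1) * ennreal V \<le> ennreal W * G x" .
      have "(S / V) powr (p - 1) \<le> C * V / W"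
      proof -
        have "W * S powr (p - 1) \<le> C * (V powr (p - 1) * V)"
          using C(6)[OF r, of c] pos powr_add[of V "p - 1" 1] by (simp add: V_def W_def S_def)
        then show ?thesis
          using pos by (simp add: powr_divide field_simps)
      qed
      have "b / ennreal V = b * ennreal (1 / S) * ennreal (S / V)"
        using pos by (simp add: divide_ennreal_def inverse_ennreal inverse_eq_divide mult.assoc ennreal_mult[symmetric])
      then have "epowr (b / ennreal V) (p - 1) = epowr (b * ennreal (1 / S)) (p - 1) * ennreal ((S / V) powr (p - 1))"
        using pos by (simp add: epowr_mult epowr_ennreal)
      also have "\<dots> \<le> epowr (b * ennreal (1 / S)) (p - 1) * ennreal (C * V / W)"
        using \<open>(S / V) powr (p - 1) \<le> C * V / W\<close> by (intro mult_left_mono ennreal_leI) auto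
      also have "\<dots> = ennreal (C / W) * (epowr (b * ennreal (1 / S)) (p - 1) * ennreal V)"
        using pos C(1) ennreal_mult[of "C / W" V] by (simp add: mult_ac)
      also have "\<dots> \<le> ennreal (C / W) * (ennreal W * G x)"
        by (rule mult_left_mono[OF 1]) simp
      also have "\<dots> = ennreal C * G x"
        using pos C(1) by (simp add: mult.assoc[symmetric] ennreal_mult[symmetric])
      finally show ?thesis by (simp add: V b_def[symmetric] del: emeasure_completion)
    qed
    \<comment> \<open>Taking the root of the estimate for each average first avoids exchanging
      \<open>epowr\<close> with a supremum.\<close>
    have "maxop lebesgue f x \<le> epowr (ennreal C * G x) (1 / (p - 1))"
    proof (rule maxop_least)
      fix c r assume "0 < r" "x \<in> ball c r"
      from epowr_mono[OF _ avg[OF this], of "1 / (p - 1)"]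
      show "(\<integral>\<^sup>+ y\<in>ball c r. f y \<partial>lebesgue) / emeasure lebesgue (ball c r) \<le> epowr (ennreal C * G x) (1 / (p - 1))"
        using p by (simp add: epowr_epowr)
    qed
    then have "epowr (maxop lebesgue f x) (p - 1) \<le> epowr (epowr (ennreal C * G x) (1 / (p - 1))) (p - 1)"
      using p by (intro epowr_mono) auto
    then show "epowr (maxop lebesgue f x) (p - 1) \<le> ennreal C * maxop (weight_measure \<omega>)
      (\<lambda>y. epowr (maxop (dual_measure p \<omega>) (\<lambda>z. f z / weight_dual p \<omega> z) y) (p - 1) / ennreal (\<omega> y)) x"
      using p by (simp add: epowr_epowr G_def F_def)
  qed
qed

text \<open>With \<open>q = p / (p - 1)\<close> the exponents fit: the bound in \<open>L^q\<close>
  of \<open>\<omega>\<close> removes the outer operator,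
  \<open>\<omega> * g powr q = \<sigma> * F powr p\<close> moves to the dual measure, the bound in
  \<open>L^p\<close> of \<open>\<sigma>\<close> removes the inner operator, and
  \<open>\<sigma> * (f / \<sigma>) powr p = f powr p * \<omega>\<close> leads back to
  \<open>\<omega>\<close>.\<close>

theorem Muckenhoupt_maximal:
  fixes \<omega> :: "'a::euclidean_space \<Rightarrow> real"
  assumes A: "Muckenhoupt p \<omega>" and p: "1 < p"
  obtains K where "0 < K" "\<And>f. f \<in> borel_measurable lebesgue \<Longrightarrow>
    (\<integral>\<^sup>+ x. epowr (maxop lebesgue f x) p * ennreal (\<omega> x) \<partial>lebesgue)
      \<le> ennreal K * (\<integral>\<^sup>+ x. epowr (f x) p * ennreal (\<omega> x) \<partial>lebesgue)"
proof -
  have w: "is_weight \<omega>" using A by (simp add: Muckenhoupt_def)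
  have [measurable]: "\<omega> \<in> borel_measurable lebesgue" by (rule borel_measurable_is_weight[OF w])
  have [measurable]: "weight_dual p \<omega> \<in> borel_measurable lebesgue"
    by (rule borel_measurable_weight_dual) simp
  define q where "q = p / (p - 1)"
  have q: "1 < q" "(p - 1) * q = p" using p by (auto simp: q_def field_simps)
  obtain D where D: "doubling D (weight_measure \<omega>)" "doubling D (dual_measure p \<omega>)"
    using Muckenhoupt_doubling[OF A p] .
  obtain K1 where K1: "0 \<le> K1" "\<And>f. f \<in> borel_measurable (weight_measure \<omega>) \<Longrightarrow>
    (\<integral>\<^sup>+ x. epowr (maxop (weight_measure \<omega>) f x) q \<partial>weight_measure \<omega>)
      \<le> ennreal K1 * (\<integral>\<^sup>+ x. epowr (f x) q \<partial>weight_measure \<omega>)"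
    by (rule maxop_strong_type[OF D(1) q(1)]) blast
  obtain K2 where K2: "0 \<le> K2" "\<And>f. f \<in> borel_measurable (dual_measure p \<omega>) \<Longrightarrow>
    (\<integral>\<^sup>+ x. epowr (maxop (dual_measure p \<omega>) f x) p \<partial>dual_measure p \<omega>)
      \<le> ennreal K2 * (\<integral>\<^sup>+ x. epowr (f x) p \<partial>dual_measure p \<omega>)"
    by (rule maxop_strong_type[OF D(2) p]) blast
  obtain C where C: "0 < C" "\<And>f x. f \<in> borel_measurable lebesgue \<Longrightarrow>
    epowr (maxop lebesgue f x) (p - 1) \<le> ennreal C * maxop (weight_measure \<omega>)
      (\<lambda>y. epowr (maxop (dual_measure p \<omega>) (\<lambda>z. f z / weight_dual p \<omega> z) y) (p - 1) / ennreal (\<omega> y)) x"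
    by (rule maxop_le_maxop_maxop_dual[OF A p]) blast
  show ?thesis
  \<comment> \<open>The added 1 secures a positive constant, since \<open>K1\<close> and
    \<open>K2\<close> are only known to be nonnegative.\<close>
  proof (rule that[of "C powr q * K1 * K2 + 1"])
    show "0 < C powr q * K1 * K2 + 1" using K1(1) K2(1) by (simp add: add_nonneg_pos)
    fix f :: "'a \<Rightarrow> ennreal" assume f [measurable]: "f \<in> borel_measurable lebesgue"
    define F where "F = maxop (dual_measure p \<omega>) (\<lambda>z. f z / weight_dual p \<omega> z)"
    define g where "g y = epowr (F y) (p - 1) / ennreal (\<omega> y)" for y
    define G where "G = maxop (weight_measure \<omega>) g"
    have [measurable]: "F \<in> borel_measurable lebesgue"
      unfolding F_def by (rule borel_measurable_maxop) simp
    have [measurable]: "G \<in> borel_measurable lebesgue"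
      unfolding G_def by (rule borel_measurable_maxop) simp
    have [measurable]: "g \<in> borel_measurable lebesgue"
      unfolding g_def by measurable
    have "epowr (maxop lebesgue f x) p \<le> ennreal (C powr q) * epowr (G x) q" for x
    proof -
      have "epowr (epowr (maxop lebesgue f x) (p - 1)) q \<le> epowr (ennreal C * G x) q"
        using C(2)[OF f, of x] q by (intro epowr_mono) (auto simp: G_def g_def[abs_def] F_def)
      then show ?thesis using C(1) by (simp add: epowr_epowr q epowr_mult epowr_ennreal)
    qed
    then have "(\<integral>\<^sup>+ x. epowr (maxop lebesgue f x) p * ennreal (\<omega> x) \<partial>lebesgue)
        \<le> (\<integral>\<^sup>+ x. ennreal (C powr q) * (ennreal (\<omega> x) * epowr (G x) q) \<partial>lebesgue)"
      by (intro nn_integral_mono) (metis mult.assoc mult.commute mult_right_mono zero_le)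
    also have "\<dots> = ennreal (C powr q) * (\<integral>\<^sup>+ x. epowr (G x) q \<partial>weight_measure \<omega>)"
      by (subst nn_integral_cmult) (simp_all add: nn_integral_density)
    also have "\<dots> \<le> ennreal (C powr q) * (ennreal K1 * (\<integral>\<^sup>+ x. epowr (g x) q \<partial>weight_measure \<omega>))"
      unfolding G_def by (intro mult_left_mono K1) auto
    also have "(\<integral>\<^sup>+ x. epowr (g x) q \<partial>weight_measure \<omega>) = (\<integral>\<^sup>+ x. epowr (F x) p \<partial>dual_measure p \<omega>)"
    proof -
      have "(\<integral>\<^sup>+ x. ennreal (\<omega> x) * epowr (g x) q \<partial>lebesgue) = (\<integral>\<^sup>+ x. weight_dual p \<omega> x * epowr (F x) p \<partial>lebesgue)"
      proof (rule nn_integral_cong_AE)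
        show "AE x in lebesgue. ennreal (\<omega> x) * epowr (g x) q = weight_dual p \<omega> x * epowr (F x) p"
          using Muckenhoupt_AE_pos[OF A]
        proof eventually_elim
          case (elim x)
          have "\<omega> x * (1 / \<omega> x) powr q = \<omega> x powr (1 - q)"
            using elim by (simp add: powr_divide powr_diff)
          also have "1 - q = - (1 / (p - 1))" using p by (simp add: q_def field_simps)
          finally have "ennreal (\<omega> x) * ennreal ((1 / \<omega> x) powr q) = weight_dual p \<omega> x"
            using elim by (simp add: weight_dual_def ennreal_mult[symmetric])
          moreover have "g x = epowr (F x) (p - 1) * ennreal (1 / \<omega> x)"
            using elim by (simp add: g_def divide_ennreal_def inverse_ennreal inverse_eq_divide)
          then have "epowr (g x) q = epowr (F x) p * ennreal ((1 / \<omega> x) powr q)"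
            using elim by (simp add: epowr_mult epowr_epowr epowr_ennreal q)
          ultimately show ?case by (metis mult.assoc mult.commute)
        qed
      qed
      then show ?thesis by (simp add: nn_integral_density)
    qed
    also have "(\<integral>\<^sup>+ x. epowr (F x) p \<partial>dual_measure p \<omega>)
        \<le> ennreal K2 * (\<integral>\<^sup>+ x. epowr (f x / weight_dual p \<omega> x) p \<partial>dual_measure p \<omega>)"
      unfolding F_def by (intro K2) auto
    also have "(\<integral>\<^sup>+ x. epowr (f x / weight_dual p \<omega> x) p \<partial>dual_measure p \<omega>)
        = (\<integral>\<^sup>+ x. epowr (f x) p * ennreal (\<omega> x) \<partial>lebesgue)"
    proof -
      have "(\<integral>\<^sup>+ x. weight_dual p \<omega> x * epowr (f x / weight_dual p \<omega> x) p \<partial>lebesgue)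
          = (\<integral>\<^sup>+ x. epowr (f x) p * ennreal (\<omega> x) \<partial>lebesgue)"
      proof (rule nn_integral_cong_AE)
        show "AE x in lebesgue. weight_dual p \<omega> x * epowr (f x / weight_dual p \<omega> x) p = epowr (f x) p * ennreal (\<omega> x)"
          using Muckenhoupt_AE_pos[OF A]
        proof eventually_elim
          case (elim x)
          define s where "s = \<omega> x powr (- (1 / (p - 1)))"
          have s: "0 < s" "weight_dual p \<omega> x = ennreal s" using elim by (auto simp: s_def weight_dual_def)
          have e: "- (1 / (p - 1)) * (1 - p) = 1" using p by (simp add: field_simps)
          have "s * (1 / s) powr p = s powr (1 - p)"
            using s by (simp add: powr_divide powr_diff)
          also have "\<dots> = \<omega> x powr 1" unfolding s_def powr_powr e ..
          finally have "s * (1 / s) powr p = \<omega> x" using elim by simp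
          then have "ennreal s * ennreal ((1 / s) powr p) = ennreal (\<omega> x)"
            using s by (simp add: ennreal_mult[symmetric])
          moreover have "epowr (f x / weight_dual p \<omega> x) p = epowr (f x) p * ennreal ((1 / s) powr p)"
            using s by (simp add: divide_ennreal_def inverse_ennreal inverse_eq_divide epowr_mult epowr_ennreal)
          ultimately show ?case unfolding s(2) by (metis mult.left_commute)
        qed
      qed
      then show ?thesis by (simp add: nn_integral_density)
    qed
    finally have "(\<integral>\<^sup>+ x. epowr (maxop lebesgue f x) p * ennreal (\<omega> x) \<partial>lebesgue)
        \<le> ennreal (C powr q) * (ennreal K1 * (ennreal K2 * (\<integral>\<^sup>+ x. epowr (f x) p * ennreal (\<omega> x) \<partial>lebesgue)))"
      by (simp add: mult_left_mono)
    also have "\<dots> = ennreal (C powr q * K1 * K2) * (\<integral>\<^sup>+ x. epowr (f x) p * ennreal (\<omega> x) \<partial>lebesgue)"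
      using K1(1) K2(1) by (simp add: ennreal_mult mult.assoc)
    also have "\<dots> \<le> ennreal (C powr q * K1 * K2 + 1) * (\<integral>\<^sup>+ x. epowr (f x) p * ennreal (\<omega> x) \<partial>lebesgue)"
      by (intro mult_right_mono ennreal_leI) auto
    finally show "(\<integral>\<^sup>+ x. epowr (maxop lebesgue f x) p * ennreal (\<omega> x) \<partial>lebesgue)
      \<le> ennreal (C powr q * K1 * K2 + 1) * (\<integral>\<^sup>+ x. epowr (f x) p * ennreal (\<omega> x) \<partial>lebesgue)" .
  qed
qed

section \<open>Weak Phi-functions at a point\<close>

text \<open>Collects what holds for \<open>\<psi> = \<phi> x\<close> at almost every
  \<open>x\<close>. The constants \<open>a\<close> from (aInc) and \<open>b\<close> from (A0) do not
  depend on \<open>x\<close>, so the lemmas below have uniform constants.\<close>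

definition regular_Phi :: "real \<Rightarrow> real \<Rightarrow> real \<Rightarrow> (real \<Rightarrow> ennreal) \<Rightarrow> bool" where
  "regular_Phi p a b \<psi> \<longleftrightarrow> mono_on {0..} \<psi> \<and> \<psi> 0 = 0 \<and> (\<psi> \<longlongrightarrow> \<infinity>) at_top \<and>
    (\<forall>s t. 0 < s \<and> s < t \<longrightarrow> \<psi> s * ennreal (t powr p) \<le> ennreal a * \<psi> t * ennreal (s powr p)) \<and>
    \<psi> b \<le> 1 \<and> 1 \<le> \<psi> (1 / b)"

context
  fixes p a b :: real and \<psi> :: "real \<Rightarrow> ennreal"
  assumes p: "1 < p" and a: "1 \<le> a" and b: "0 < b" "b \<le> 1" and reg: "regular_Phi p a b \<psi>"
begin

lemma regular_mono: "0 \<le> s \<Longrightarrow> s \<le> t \<Longrightarrow> \<psi> s \<le> \<psi> t"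
  using reg by (auto simp: regular_Phi_def mono_on_def)

lemma regular_0: "\<psi> 0 = 0"
  using reg by (auto simp: regular_Phi_def)

lemma regular_scale:
  assumes "0 < e" "e \<le> 1" "0 \<le> t"
  shows "\<psi> (e * t) \<le> ennreal (a * e powr p) * \<psi> t"
\<comment> \<open>(aInc) compares arguments with \<open>0 < s < t\<close> only; these are the cases
  where the comparison degenerates.\<close>
proof (cases "e = 1 \<or> t = 0")
  case True
  have "1 * \<psi> t \<le> ennreal a * \<psi> t"
    using a by (intro mult_right_mono) auto
  with True show ?thesis by (auto simp: regular_0)
next
  case False
  then have "0 < e * t" "e * t < t" using assms by auto
  then have "\<psi> (e * t) * ennreal (t powr p) \<le> ennreal a * \<psi> t * ennreal ((e * t) powr p)"
    using reg by (auto simp: regular_Phi_def)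
  also have "\<dots> = (ennreal (a * e powr p) * \<psi> t) * ennreal (t powr p)"
    using assms a by (simp add: powr_mult ennreal_mult mult_ac)
  finally show ?thesis
    using False assms by (simp add: mult.commute[of _ "ennreal (t powr p)"] ennreal_mult_le_mult_iff)
qed

text \<open>The \<open>p\<close>-th root of (aInc): \<open>\<psi> powr (1 / p)\<close> grows at
  least linearly up to a constant. It supplies the hypothesis \<open>le\<close> of
  \<open>average_lower_bound\<close>.\<close>

lemma regular_root:
  assumes "0 < t" "t \<le> s"
  shows "ennreal (s / t) * epowr (\<psi> t) (1 / p) \<le> ennreal (a powr (1 / p)) * epowr (\<psi> s) (1 / p)"
proof -
  have "\<psi> t \<le> ennreal (a * (t / s) powr p) * \<psi> s"
    using regular_scale[of "t / s" s] assms by simp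
  then have "epowr (\<psi> t) (1 / p) \<le> epowr (ennreal (a * (t / s) powr p) * \<psi> s) (1 / p)"
    using p by (intro epowr_mono) auto
  also have "\<dots> = ennreal (a powr (1 / p) * (t / s)) * epowr (\<psi> s) (1 / p)"
    using p a assms by (simp add: epowr_mult epowr_ennreal powr_mult powr_powr)
  finally have "ennreal (s / t) * epowr (\<psi> t) (1 / p)
      \<le> ennreal (s / t) * (ennreal (a powr (1 / p) * (t / s)) * epowr (\<psi> s) (1 / p))"
    by (rule mult_left_mono) simp
  also have "\<dots> = ennreal (s / t * (a powr (1 / p) * (t / s))) * epowr (\<psi> s) (1 / p)"
    using assms by (simp add: mult.assoc[symmetric] ennreal_mult[symmetric])
  also have "s / t * (a powr (1 / p) * (t / s)) = a powr (1 / p)"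
    using assms by simp
  finally show ?thesis .
qed

text \<open>Linear growth of the root, started at \<open>1 / b\<close>, where (A0) gives at least 1.
  It bounds large function values by a multiple of \<open>u\<close>.\<close>

lemma regular_ge:
  assumes "1 / b \<le> s"
  shows "ennreal (b * s) \<le> ennreal (a powr (1 / p)) * epowr (\<psi> s) (1 / p)"
proof -
  have "1 \<le> epowr (\<psi> (1 / b)) (1 / p)"
    using reg p epowr_mono[of "1 / p" 1 "\<psi> (1 / b)"] epowr_ennreal[of 1 "1 / p"] by (auto simp: regular_Phi_def)
  then have "ennreal (b * s) * 1 \<le> ennreal (b * s) * epowr (\<psi> (1 / b)) (1 / p)"
    by (rule mult_left_mono) simp
  also have "\<dots> \<le> ennreal (a powr (1 / p)) * epowr (\<psi> s) (1 / p)"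
    using regular_root[of "1 / b" s] assms b by (simp add: mult.commute)
  finally show ?thesis by simp
qed

text \<open>Scales down from \<open>\<psi> b \<le> 1\<close>. It serves when an average is too small
  for (A1).\<close>

lemma regular_le:
  assumes "0 \<le> t" "t \<le> b"
  shows "\<psi> t \<le> ennreal (a * (t / b) powr p)"
proof (cases "t = 0")
  case False
  have "\<psi> t \<le> ennreal (a * (t / b) powr p) * \<psi> b"
    using regular_scale[of "t / b" b] assms b False by simp
  also have "\<dots> \<le> ennreal (a * (t / b) powr p) * 1"
    using reg by (intro mult_left_mono) (auto simp: regular_Phi_def)
  finally show ?thesis by simp
qed (simp add: regular_0)

end

section \<open>Averages over a single ball: large values and small values\<close>

text \<open>Replaces Jensen's inequality: the values of f above half its average carry at least half of
  the integral.\<close>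
lemma average_lower_bound:
  fixes f :: "'a \<Rightarrow> real" and H :: "'a \<Rightarrow> ennreal"
  assumes B: "B \<in> sets M" "emeasure M B < top" and A: "0 < A"
    and f [measurable]: "f \<in> borel_measurable M" and H [measurable]: "H \<in> borel_measurable M"
    and avg: "(\<integral>\<^sup>+ y\<in>B. ennreal (f y) \<partial>M) = ennreal A * emeasure M B"
    and le: "AE y in M. y \<in> B \<longrightarrow> A / 2 < f y \<longrightarrow> ennreal (f y / (A / 2)) * R \<le> H y"
  shows "R * emeasure M B \<le> (\<integral>\<^sup>+ y\<in>B. H y \<partial>M)"
proof -
  note [measurable] = B(1)
  define g where "g y = ennreal (f y) * indicator {y. A / 2 < f y} y * indicator B y" for y
  have gm [measurable]: "g \<in> borel_measurable M"
    unfolding g_def[abs_def] indicator_def by measurable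
  have "ennreal (A / 2) * emeasure M B + ennreal (A / 2) * emeasure M B = ennreal A * emeasure M B"
    using A by (simp add: distrib_right[symmetric] flip: ennreal_plus)
  also have "\<dots> \<le> (\<integral>\<^sup>+ y. g y + ennreal (A / 2) * indicator B y \<partial>M)"
    unfolding avg[symmetric] by (intro nn_integral_mono) (auto simp: g_def indicator_def intro!: ennreal_leI)
  also have "\<dots> = (\<integral>\<^sup>+ y. g y \<partial>M) + ennreal (A / 2) * emeasure M B"
    by (subst nn_integral_add) (auto simp: nn_integral_cmult_indicator)
  \<comment> \<open>\<open>B\<close> has finite measure, so \<open>A / 2\<close> times this measure
    can be cancelled on both sides.\<close>
  finally have half: "ennreal (A / 2) * emeasure M B \<le> (\<integral>\<^sup>+ y. g y \<partial>M)"
    using B(2) by (auto simp: ennreal_mult_eq_top_iff)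
  have "R * emeasure M B = ennreal (2 / A) * R * (ennreal (A / 2) * emeasure M B)"
  proof -
    have "ennreal (2 / A) * ennreal (A / 2) = 1"
      using A by (simp flip: ennreal_mult)
    then show ?thesis by (metis mult.assoc mult.commute mult.left_neutral)
  qed
  also have "\<dots> \<le> ennreal (2 / A) * R * (\<integral>\<^sup>+ y. g y \<partial>M)"
    by (rule mult_left_mono[OF half]) simp
  also have "\<dots> = (\<integral>\<^sup>+ y. ennreal (2 / A) * R * g y \<partial>M)"
    by (rule nn_integral_cmult[symmetric]) simp
  also have "\<dots> \<le> (\<integral>\<^sup>+ y\<in>B. H y \<partial>M)"
  proof (rule nn_integral_mono_AE)
    show "AE y in M. ennreal (2 / A) * R * g y \<le> H y * indicator B y"
      using le
    proof eventually_elim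
      case (elim y)
      have "ennreal (f y / (A / 2)) * R = ennreal (2 / A) * R * ennreal (f y)"
        using A ennreal_mult'[of "2 / A" "f y"] by (simp add: mult_ac)
      with elim show ?case by (auto simp: g_def indicator_def)
    qed
  qed
  finally show ?thesis .
qed

text \<open>Intended reading: \<open>f\<close> is the part of the function above
  \<open>1 / b\<close>, \<open>A\<close> its average, \<open>W\<close> the weight of the ball, and
  \<open>\<psi>\<close> is \<open>\<phi>\<close> at the point where the maximal function is
  estimated. \<open>c\<close> and \<open>K\<close> precede all of these, so they are uniform. A
  bounded \<open>A\<close> needs only (A0) and (aInc), because the average of \<open>u\<close>
  controls \<open>A\<close>; for a large \<open>A\<close> the bound is found at one point
  \<open>y\<close> of the ball and carried over to \<open>\<psi>\<close> by the last clause, which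
  is (A1).\<close>

lemma large_part_estimate:
  fixes p a b C \<beta> :: real
  assumes p: "1 < p" and a: "1 \<le> a" and b: "0 < b" "b \<le> 1" and C: "0 < C" and \<beta>: "0 < \<beta>"
  obtains c K where "0 < c" "0 < K"
    "\<And>M B W A \<psi> (\<phi> :: 'a \<Rightarrow> real \<Rightarrow> ennreal) f u.
      \<lbrakk>B \<in> sets M; 0 < emeasure M B; emeasure M B < top; 0 \<le> A; 0 < W;
       f \<in> borel_measurable M; u \<in> borel_measurable M;
       (\<integral>\<^sup>+ y\<in>B. ennreal (f y) \<partial>M) = ennreal A * emeasure M B;
       epowr ((\<integral>\<^sup>+ y\<in>B. u y \<partial>M) / emeasure M B) p * ennreal W \<le> ennreal C;
       regular_Phi p a b \<psi>;
       AE y in M. y \<in> B \<longrightarrow> f y = 0 \<or> 1 / b < f y \<and> regular_Phi p a b (\<phi> y) \<and>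
         u y = epowr (\<phi> y (f y)) (1 / p) \<and>
         (\<forall>t\<ge>0. 1 \<le> \<phi> y t \<and> \<phi> y t \<le> 1 / ennreal W \<longrightarrow> \<psi> (\<beta> * t) \<le> \<phi> y t)\<rbrakk>
      \<Longrightarrow> \<psi> (c * A) \<le> ennreal K * epowr ((\<integral>\<^sup>+ y\<in>B. u y \<partial>M) / emeasure M B) p"
proof -
  \<comment> \<open>Chosen so that \<open>a * e powr p\<close> times \<open>2 powr p * a * C\<close>
    is at most 1: shrinking the argument by \<open>e\<close> pushes the value at \<open>y\<close>
    below \<open>1 / W\<close>.\<close>
  define e where "e = min 1 ((2 powr p * a\<^sup>2 * C) powr (- (1 / p)))"
  have e: "0 < e" "e \<le> 1" using a C by (auto simp: e_def)
  have eC: "a * e powr p * (2 powr p * a * C) \<le> 1"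
  proof -
    have "e powr p \<le> ((2 powr p * a\<^sup>2 * C) powr (- (1 / p))) powr p"
      using p e by (intro powr_mono2) (auto simp: e_def)
    also have "\<dots> = (2 powr p * a\<^sup>2 * C) powr (- 1)"
      using p by (simp add: powr_powr)
    also have "\<dots> = 1 / (2 powr p * a\<^sup>2 * C)"
      using a C by (simp add: powr_minus_divide)
    finally have "e powr p * (2 powr p * a\<^sup>2 * C) \<le> 1"
      using a C by (simp add: pos_le_divide_eq)
    then show ?thesis by (simp add: power2_eq_square mult_ac)
  qed
  \<comment> \<open>\<open>A > L\<close> means \<open>e * (A / 2) > 1 / b\<close>, so that the
    shrunken argument still gives a value at least 1.\<close>
  define L where "L = 2 / (e * b)"
  have L: "0 < L" "e * (L / 2) = 1 / b" using e b by (auto simp: L_def)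
  \<comment> \<open>\<open>b / L\<close> gives \<open>c * A \<le> b\<close> when
    \<open>A \<le> L\<close>; \<open>\<beta> * e / 2\<close> is what (A1) yields at the argument
    \<open>e * (A / 2)\<close>.\<close>
  define c where "c = min (b / L) (\<beta> * e / 2)"
  have c: "0 < c" using b L \<beta> e by (simp add: c_def)
  have c': "c \<le> b / L" "c \<le> \<beta> * e / 2" unfolding c_def by (rule min.cobounded1 min.cobounded2)+
  define K1 where "K1 = a * (c / b) powr p * (a / b powr p)"
  define K2 where "K2 = a * e powr p * (2 powr p * a)"
  have K: "0 < K1" "0 < K2" using a b c e by (auto simp: K1_def K2_def)
  show ?thesis
  proof (rule that[of c "max K1 K2"])
    show "0 < c" "0 < max K1 K2" using c K by auto
    fix M :: "'a measure" and B W A \<psi> and \<phi> :: "'a \<Rightarrow> real \<Rightarrow> ennreal" and f u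
    assume B [measurable]: "B \<in> sets M" and B0: "0 < emeasure M B" "emeasure M B < top"
      and A: "0 \<le> A" and W: "0 < W"
      and fm [measurable]: "f \<in> borel_measurable M" and um [measurable]: "u \<in> borel_measurable M"
      and avg: "(\<integral>\<^sup>+ y\<in>B. ennreal (f y) \<partial>M) = ennreal A * emeasure M B"
      and VW: "epowr ((\<integral>\<^sup>+ y\<in>B. u y \<partial>M) / emeasure M B) p * ennreal W \<le> ennreal C"
      and \<psi>: "regular_Phi p a b \<psi>"
      and ae: "AE y in M. y \<in> B \<longrightarrow> f y = 0 \<or> 1 / b < f y \<and> regular_Phi p a b (\<phi> y) \<and>
         u y = epowr (\<phi> y (f y)) (1 / p) \<and>
         (\<forall>t\<ge>0. 1 \<le> \<phi> y t \<and> \<phi> y t \<le> 1 / ennreal W \<longrightarrow> \<psi> (\<beta> * t) \<le> \<phi> y t)"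
    note reg = p a b
    define V where "V = (\<integral>\<^sup>+ y\<in>B. u y \<partial>M) / emeasure M B"
    have intu: "(\<integral>\<^sup>+ y\<in>B. u y \<partial>M) = V * emeasure M B"
      using B0 by (simp add: V_def ennreal_divide_times)
    have Vfin: "V < top"
    proof (rule ccontr)
      assume "\<not> V < top"
      then have "V = top" using top.not_eq_extremum by blast
      with VW W show False by (simp add: V_def[symmetric] top_unique)
    qed
    then obtain v where v: "V = ennreal v" "0 \<le> v" by (cases V) auto
    have vW: "v powr p * W \<le> C"
      using VW W v C by (simp add: V_def[symmetric] epowr_ennreal ennreal_mult[symmetric])
    \<comment> \<open>Where \<open>f\<close> does not vanish it exceeds \<open>1 / b\<close>, so
      \<open>regular_ge\<close> bounds \<open>b * f\<close> by \<open>a powr (1 / p) * u\<close>;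
      this is averaged.\<close>
    have Av: "b * A \<le> a powr (1 / p) * v"
    proof -
      have "ennreal b * (ennreal A * emeasure M B) = (\<integral>\<^sup>+ y. ennreal b * (ennreal (f y) * indicator B y) \<partial>M)"
        unfolding avg[symmetric] by (rule nn_integral_cmult[symmetric]) measurable
      also have "\<dots> \<le> (\<integral>\<^sup>+ y. ennreal (a powr (1 / p)) * (u y * indicator B y) \<partial>M)"
      proof (rule nn_integral_mono_AE)
        show "AE y in M. ennreal b * (ennreal (f y) * indicator B y) \<le> ennreal (a powr (1 / p)) * (u y * indicator B y)"
          using ae
        proof eventually_elim
          case (elim y)
          have "ennreal b * ennreal (f y) \<le> ennreal (a powr (1 / p)) * u y" if "y \<in> B"
            using elim that regular_ge[OF reg, of "\<phi> y" "f y"] b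
            by (auto simp: ennreal_mult'[symmetric])
          then show ?case by (auto simp: indicator_def)
        qed
      qed
      also have "\<dots> = ennreal (a powr (1 / p)) * (V * emeasure M B)"
        unfolding intu[symmetric] by (rule nn_integral_cmult) measurable
      finally have "ennreal (b * A) * emeasure M B \<le> ennreal (a powr (1 / p) * v) * emeasure M B"
        using A b v by (simp add: ennreal_mult mult.assoc)
      then have "ennreal (b * A) \<le> ennreal (a powr (1 / p) * v)"
        using B0 by (simp add: mult.commute[of _ "emeasure M B"] ennreal_mult_le_mult_iff)
      then show ?thesis using v by simp
    qed
    have fin: "\<psi> (c * A) \<le> ennreal (max K1 K2) * epowr V p" if "\<psi> (c * A) \<le> ennreal (k * v powr p)" "k \<le> max K1 K2" for k
    proof -
      note that(1)
      also have "ennreal (k * v powr p) \<le> ennreal (max K1 K2 * v powr p)"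
        using that(2) by (intro ennreal_leI mult_right_mono) auto
      also have "\<dots> = ennreal (max K1 K2) * epowr V p"
        using v K by (simp add: epowr_ennreal ennreal_mult)
      finally show ?thesis .
    qed
    consider "A = 0" | "0 < A" "A \<le> L" | "L < A" using A by linarith
    then have "\<psi> (c * A) \<le> ennreal (max K1 K2) * epowr V p"
    proof cases
      case 1
      then show ?thesis by (simp add: regular_0[OF reg \<psi>])
    next
      case 2
      have "c * A \<le> b / L * L" using c c' 2 b L by (intro mult_mono) auto
      then have cb: "c * A \<le> b" using L by simp
      have "A powr p \<le> (a powr (1 / p) * v / b) powr p"
        using Av b A p by (intro powr_mono2) (auto simp: field_simps)
      also have "\<dots> = a / b powr p * v powr p"
        using a b v p by (simp add: powr_divide powr_mult powr_powr)
      finally have Ap: "A powr p \<le> a / b powr p * v powr p" .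
      have "\<psi> (c * A) \<le> ennreal (a * (c * A / b) powr p)"
        using c A cb by (intro regular_le[OF reg \<psi>]) auto
      also have "a * (c * A / b) powr p = a * (c / b) powr p * A powr p"
        using c A b by (simp add: powr_mult powr_divide)
      also have "ennreal \<dots> \<le> ennreal (K1 * v powr p)"
        using mult_left_mono[OF Ap, of "a * (c / b) powr p"] a by (intro ennreal_leI) (simp add: K1_def mult.assoc)
      finally show ?thesis by (rule fin) simp
    next
      case 3
      then have A0: "0 < A" using L by simp
      then have v0: "0 < v" using Av a b v by (cases "v = 0") (auto simp: mult_le_0_iff)
      \<comment> \<open>Otherwise \<open>\<phi> y (A / 2)\<close> exceeds the bound at almost every
        \<open>y\<close> of \<open>B\<close> where \<open>f\<close> exceeds \<open>A / 2\<close>.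
        The root of the bound is \<open>a powr (1 / p) * (2 * v)\<close>; its first factor is used
        up by \<open>regular_root\<close>, and averaging leaves \<open>2 * v \<le> v\<close> for a
        positive \<open>v\<close>.\<close>
      have "\<exists>y. y \<in> B \<and> A / 2 < f y \<and> 1 / b < f y \<and> regular_Phi p a b (\<phi> y) \<and>
         (\<forall>t\<ge>0. 1 \<le> \<phi> y t \<and> \<phi> y t \<le> 1 / ennreal W \<longrightarrow> \<psi> (\<beta> * t) \<le> \<phi> y t) \<and>
         \<phi> y (A / 2) \<le> ennreal (2 powr p * a * v powr p)"
      proof (rule ccontr)
        assume neg: "\<not> ?thesis"
        have "AE y in M. y \<in> B \<longrightarrow> A / 2 < f y \<longrightarrow> ennreal (f y / (A / 2)) * ennreal (2 * v) \<le> u y"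
          using ae
        proof eventually_elim
          case (elim y)
          show ?case
          proof (intro impI)
            assume y: "y \<in> B" "A / 2 < f y"
            then have "f y \<noteq> 0" using A0 by auto
            with elim y have y': "1 / b < f y" "regular_Phi p a b (\<phi> y)" "u y = epowr (\<phi> y (f y)) (1 / p)"
              "\<forall>t\<ge>0. 1 \<le> \<phi> y t \<and> \<phi> y t \<le> 1 / ennreal W \<longrightarrow> \<psi> (\<beta> * t) \<le> \<phi> y t" by auto
            with neg y have "ennreal (2 powr p * a * v powr p) \<le> \<phi> y (A / 2)"
              by (meson linear)
            then have "epowr (ennreal (2 powr p * a * v powr p)) (1 / p) \<le> epowr (\<phi> y (A / 2)) (1 / p)"
              using p by (intro epowr_mono) auto
            also have "epowr (ennreal (2 powr p * a * v powr p)) (1 / p) = ennreal (a powr (1 / p)) * ennreal (2 * v)"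
              using p a v by (simp add: epowr_ennreal powr_mult powr_powr ennreal_mult[symmetric] mult_ac)
            finally have "ennreal (f y / (A / 2)) * (ennreal (a powr (1 / p)) * ennreal (2 * v))
                \<le> ennreal (f y / (A / 2)) * epowr (\<phi> y (A / 2)) (1 / p)"
              by (rule mult_left_mono) simp
            also have "\<dots> \<le> ennreal (a powr (1 / p)) * u y"
              unfolding y'(3) using y A0 by (intro regular_root[OF reg y'(2)]) auto
            finally have "ennreal (a powr (1 / p)) * (ennreal (f y / (A / 2)) * ennreal (2 * v)) \<le> ennreal (a powr (1 / p)) * u y"
              by (simp only: mult_ac)
            then show "ennreal (f y / (A / 2)) * ennreal (2 * v) \<le> u y"
              using a by (subst (asm) ennreal_mult_le_mult_iff) auto
          qed
        qed
        then have "ennreal (2 * v) * emeasure M B \<le> (\<integral>\<^sup>+ y\<in>B. u y \<partial>M)"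
          by (rule average_lower_bound[OF B B0(2) A0 fm um avg])
        then have "ennreal (2 * v) \<le> ennreal v"
          unfolding intu v(1) using B0 by (simp add: mult.commute[of _ "emeasure M B"] ennreal_mult_le_mult_iff)
        then show False using v0 by simp
      qed
      then obtain y where y: "y \<in> B" "A / 2 < f y" "regular_Phi p a b (\<phi> y)"
         "\<And>t. 0 \<le> t \<Longrightarrow> 1 \<le> \<phi> y t \<Longrightarrow> \<phi> y t \<le> 1 / ennreal W \<Longrightarrow> \<psi> (\<beta> * t) \<le> \<phi> y t"
         "\<phi> y (A / 2) \<le> ennreal (2 powr p * a * v powr p)" by blast
      \<comment> \<open>(A1) is to be applied at \<open>e * (A / 2)\<close>: the factor
        \<open>e\<close> ensures the upper end of its range, \<open>A > L\<close> the lower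
        end.\<close>
      have "\<phi> y (e * (A / 2)) \<le> ennreal (a * e powr p) * \<phi> y (A / 2)"
        using e A by (intro regular_scale[OF reg y(3)]) auto
      also have "\<dots> \<le> ennreal (a * e powr p) * ennreal (2 powr p * a * v powr p)"
        by (rule mult_left_mono[OF y(5)]) simp
      also have "\<dots> = ennreal (K2 * v powr p)"
        using a by (simp add: K2_def ennreal_mult[symmetric] mult_ac)
      finally have up: "\<phi> y (e * (A / 2)) \<le> ennreal (K2 * v powr p)" .
      have "K2 * v powr p \<le> 1 / W"
      proof -
        have "K2 * (v powr p * W) \<le> K2 * C"
          using vW K by (intro mult_left_mono) auto
        also have "\<dots> \<le> 1" using eC by (simp add: K2_def mult_ac)
        finally show ?thesis using W by (simp add: field_simps)
      qed
      then have "ennreal (K2 * v powr p) \<le> 1 / ennreal W"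
        using W by (simp add: divide_ennreal[of 1, simplified])
      with up have u2: "\<phi> y (e * (A / 2)) \<le> 1 / ennreal W" by (rule order_trans)
      have "1 \<le> \<phi> y (1 / b)" using y(3) by (simp add: regular_Phi_def)
      also have "\<dots> \<le> \<phi> y (e * (A / 2))"
        using 3 e b L(2)[symmetric] by (intro regular_mono[OF reg y(3)]) (auto intro!: mult_left_mono)
      finally have "\<psi> (\<beta> * (e * (A / 2))) \<le> \<phi> y (e * (A / 2))"
        using u2 e A by (intro y(4)) auto
      moreover have "\<psi> (c * A) \<le> \<psi> (\<beta> * (e * (A / 2)))"
      proof (rule regular_mono[OF reg \<psi>])
        show "0 \<le> c * A" using c A by simp
        have "c * A \<le> \<beta> * e / 2 * A" using c' A by (intro mult_right_mono) auto
        then show "c * A \<le> \<beta> * (e * (A / 2))" by simp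
      qed
      ultimately have "\<psi> (c * A) \<le> ennreal (K2 * v powr p)"
        using up by (meson order_trans)
      then show ?thesis by (rule fin) simp
    qed
    then show "\<psi> (c * A) \<le> ennreal (max K1 K2) * epowr ((\<integral>\<^sup>+ y\<in>B. u y \<partial>M) / emeasure M B) p"
      by (simp only: V_def)
  qed
qed

text \<open>The transfer from \<open>y\<close> to the fixed point sits in the hypothesis
  \<open>ae\<close>, where the three powers stand for \<open>\<phi> (y, g y)\<close>,
  \<open>h x\<close> and \<open>h y\<close>. Applying \<open>average_lower_bound\<close> with
  \<open>R\<close> the root of \<open>\<psi> (\<beta> * (A / 2))\<close> leaves only averages. One
  factor \<open>4 powr p\<close> stems from taking the root of a sum of three terms, another from
  raising such a sum to the power \<open>p\<close>, and \<open>a\<close> from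
  \<open>regular_root\<close>.\<close>

lemma small_part_estimate:
  fixes p a b \<beta> :: real
  assumes p: "1 < p" and a: "1 \<le> a" and b: "0 < b" "b \<le> 1" and \<psi>: "regular_Phi p a b \<psi>"
    and \<beta>: "0 < \<beta>"
    and B [measurable]: "B \<in> sets M" and B0: "0 < emeasure M B" "emeasure M B < top" and A: "0 \<le> A"
    and fm [measurable]: "f \<in> borel_measurable M" and f0: "\<And>y. 0 \<le> f y"
    and um [measurable]: "u \<in> borel_measurable M" and km [measurable]: "k \<in> borel_measurable M"
    and avg: "(\<integral>\<^sup>+ y\<in>B. ennreal (f y) \<partial>M) = ennreal A * emeasure M B"
    and ae: "AE y in M. y \<in> B \<longrightarrow> f y = 0 \<or> \<psi> (\<beta> * f y) \<le> epowr (u y) p + epowr H p + epowr (k y) p"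
  shows "\<psi> (\<beta> / 2 * A) \<le> ennreal (16 powr p * a) *
    (epowr ((\<integral>\<^sup>+ y\<in>B. u y \<partial>M) / emeasure M B) p + epowr H p + epowr ((\<integral>\<^sup>+ y\<in>B. k y \<partial>M) / emeasure M B) p)"
proof (cases "A = 0")
  case True
  then show ?thesis by (simp add: regular_0[OF p a b \<psi>])
next
  case False
  with A have A0: "0 < A" by simp
  define R where "R = epowr (\<psi> (\<beta> * (A / 2))) (1 / p)"
  define D where "D = ennreal (a powr (1 / p) * 4)"
  let ?U = "(\<integral>\<^sup>+ y\<in>B. u y \<partial>M) / emeasure M B" and ?K = "(\<integral>\<^sup>+ y\<in>B. k y \<partial>M) / emeasure M B"
  have pow2: "2 powr (1 / p) \<le> 2"
    using p powr_mono[of "1 / p" 1 2] by simp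
  have split: "epowr (x + y + z) (1 / p) \<le> 4 * (epowr x (1 / p) + epowr y (1 / p) + epowr z (1 / p))" for x y z
  proof -
    have two: "epowr (x + y) (1 / p) \<le> 2 * (epowr x (1 / p) + epowr y (1 / p))" for x y
    proof -
      have "epowr (x + y) (1 / p) \<le> ennreal (2 powr (1 / p)) * (epowr x (1 / p) + epowr y (1 / p))"
        using p by (intro epowr_add_le) simp
      also have "\<dots> \<le> ennreal 2 * (epowr x (1 / p) + epowr y (1 / p))"
        using pow2 by (intro mult_right_mono ennreal_leI) auto
      finally show ?thesis by simp
    qed
    have "epowr (x + y + z) (1 / p) \<le> 2 * (epowr (x + y) (1 / p) + epowr z (1 / p))" by (rule two)
    also have "\<dots> \<le> 2 * (2 * (epowr x (1 / p) + epowr y (1 / p)) + 2 * epowr z (1 / p))"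
      using two[of x y] by (intro mult_left_mono add_mono) (auto simp: mult_2)
    also have "\<dots> = 4 * (epowr x (1 / p) + epowr y (1 / p) + epowr z (1 / p))"
      by (simp add: distrib_left mult.assoc[symmetric])
    finally show ?thesis .
  qed
  have "AE y in M. y \<in> B \<longrightarrow> A / 2 < f y \<longrightarrow> ennreal (f y / (A / 2)) * R \<le> D * (u y + H + k y)"
    using ae
  proof eventually_elim
    case (elim y)
    show ?case
    proof (intro impI)
      assume y: "y \<in> B" "A / 2 < f y"
      then have "\<psi> (\<beta> * f y) \<le> epowr (u y) p + epowr H p + epowr (k y) p"
        using elim A0 by auto
      then have "epowr (\<psi> (\<beta> * f y)) (1 / p) \<le> epowr (epowr (u y) p + epowr H p + epowr (k y) p) (1 / p)"
        using p by (intro epowr_mono) auto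
      also have "\<dots> \<le> 4 * (u y + H + k y)"
        using split[of "epowr (u y) p" "epowr H p" "epowr (k y) p"] p by (simp add: epowr_epowr)
      finally have *: "epowr (\<psi> (\<beta> * f y)) (1 / p) \<le> 4 * (u y + H + k y)" .
      have "ennreal (f y / (A / 2)) * R \<le> ennreal (a powr (1 / p)) * epowr (\<psi> (\<beta> * f y)) (1 / p)"
        using regular_root[OF p a b \<psi>, of "\<beta> * (A / 2)" "\<beta> * f y"] y A0 \<beta> by (simp add: R_def)
      also have "\<dots> \<le> ennreal (a powr (1 / p)) * (4 * (u y + H + k y))"
        by (rule mult_left_mono[OF *]) simp
      also have "\<dots> = D * (u y + H + k y)"
        by (simp add: D_def ennreal_mult mult.assoc)
      finally show "ennreal (f y / (A / 2)) * R \<le> D * (u y + H + k y)" .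
    qed
  qed
  then have "R * emeasure M B \<le> (\<integral>\<^sup>+ y\<in>B. (D * (u y + H + k y)) \<partial>M)"
    by (intro average_lower_bound[OF B B0(2) A0 fm _ avg]) measurable
  also have "\<dots> = D * (\<integral>\<^sup>+ y. u y * indicator B y + H * indicator B y + k y * indicator B y \<partial>M)"
    by (subst nn_integral_cmult[symmetric]) (auto simp: distrib_right mult.assoc)
  also have "(\<integral>\<^sup>+ y. u y * indicator B y + H * indicator B y + k y * indicator B y \<partial>M)
      = (\<integral>\<^sup>+ y\<in>B. u y \<partial>M) + H * emeasure M B + (\<integral>\<^sup>+ y\<in>B. k y \<partial>M)"
    by (simp add: nn_integral_add nn_integral_cmult_indicator)
  also have "\<dots> = (?U + H + ?K) * emeasure M B"
    using B0 by (simp add: distrib_right ennreal_divide_times)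
  finally have "R * emeasure M B \<le> D * (?U + H + ?K) * emeasure M B" by (simp add: mult.assoc)
  then have RD: "R \<le> D * (?U + H + ?K)"
    using B0 by (simp add: mult.commute[of _ "emeasure M B"] ennreal_mult_le_mult_iff)
  have "\<psi> (\<beta> / 2 * A) = epowr R p"
    using p by (simp add: R_def epowr_epowr)
  also have "\<dots> \<le> epowr (D * (?U + H + ?K)) p"
    using p RD by (intro epowr_mono) auto
  also have "\<dots> = ennreal (a * 4 powr p) * epowr (?U + H + ?K) p"
    using a p by (simp add: epowr_mult D_def epowr_ennreal powr_mult powr_powr)
  also have "\<dots> \<le> ennreal (a * 4 powr p) * (ennreal (4 powr p) * (epowr ?U p + epowr H p + epowr ?K p))"
  proof (rule mult_left_mono)
    have p0: "0 < p" and two: "1 \<le> ennreal (2 powr p)" using p by (auto simp: ge_one_powr_ge_zero)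
    have "epowr (?U + H + ?K) p \<le> ennreal (2 powr p) * (epowr (?U + H) p + epowr ?K p)"
      by (rule epowr_add_le[OF p0])
    also have "\<dots> \<le> ennreal (2 powr p) * (ennreal (2 powr p) * (epowr ?U p + epowr H p) + ennreal (2 powr p) * epowr ?K p)"
      using mult_right_mono[OF two, of "epowr ?K p"]
      by (intro mult_left_mono add_mono epowr_add_le[OF p0]) auto
    also have "\<dots> = ennreal (2 powr p * 2 powr p) * (epowr ?U p + epowr H p + epowr ?K p)"
      by (simp add: ennreal_mult distrib_left mult.assoc)
    also have "2 powr p * 2 powr p = (4::real) powr p"
      using powr_mult[of 2 2 p] by simp
    finally show "epowr (?U + H + ?K) p \<le> ennreal (4 powr p) * (epowr ?U p + epowr H p + epowr ?K p)" .
  qed simp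
  also have "\<dots> = ennreal (a * 4 powr p * 4 powr p) * (epowr ?U p + epowr H p + epowr ?K p)"
    using a by (simp add: ennreal_mult mult.assoc)
  also have "a * 4 powr p * 4 powr p = 16 powr p * a"
    using powr_mult[of 4 4 p] by (simp add: mult_ac)
  finally show ?thesis .
qed

section \<open>Modular estimates for the maximal operator\<close>

lemma maxop_cmult:
  assumes "sets M = sets lebesgue" "f \<in> borel_measurable M"
  shows "maxop M (\<lambda>y. t * f y) x = t * maxop M f x"
proof -
  have "(\<integral>\<^sup>+ y\<in>ball c r. (t * f y) \<partial>M) = t * (\<integral>\<^sup>+ y\<in>ball c r. f y \<partial>M)" for c r
  proof -
    have [measurable]: "ball c r \<in> sets M" "f \<in> borel_measurable M" using assms by auto
    show ?thesis unfolding mult.assoc by (rule nn_integral_cmult) measurable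
  qed
  then show ?thesis
    unfolding maxop_def SUP_mult_left_ennreal
    by (intro SUP_cong) (auto simp: ennreal_times_divide)
qed

section \<open>From all balls to countably many, and from averages to their supremum\<close>

lemma maximal_eq_maxop:
  "maximal \<Omega> f x = maxop lebesgue (\<lambda>y. ennreal \<bar>f y\<bar> * indicator \<Omega> y) x"
  unfolding maximal_def maxop_def
  by (rule SUP_cong) (simp_all add: indicator_inter_arith mult_ac split_beta)

text \<open>A centre \<open>d\<close> within \<open>r / 2\<close> of \<open>c\<close> and a radius
  \<open>q\<close> between \<open>3 * r / 2\<close> and \<open>2 * r\<close> give a ball that
  contains the old one and has at most \<open>2 ^ DIM('a)\<close> times its volume. With countably
  many balls, the null sets that (A1) attaches to single balls can be united.\<close>

lemma less_maxop_dense: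
  fixes D :: "'a::euclidean_space set"
  assumes D: "\<And>X. open X \<Longrightarrow> X \<noteq> {} \<Longrightarrow> \<exists>d\<in>D. d \<in> X"
    and s: "s < maxop lebesgue f x"
  obtains c r where "c \<in> D" "r \<in> \<rat>" "0 < r" "x \<in> ball c r"
    "s < ennreal (2 ^ DIM('a)) * ((\<integral>\<^sup>+ y\<in>ball c r. f y \<partial>lebesgue) / emeasure lebesgue (ball c r))"
proof -
  obtain c r where cr: "0 < r" "x \<in> ball c r"
    "s < (\<integral>\<^sup>+ y\<in>ball c r. f y \<partial>lebesgue) / emeasure lebesgue (ball c r)"
    using s unfolding less_maxop_iff by blast
  obtain d where d: "d \<in> D" "d \<in> ball c (r / 2)"
    using D[of "ball c (r / 2)"] cr by auto
  obtain q where q: "q \<in> \<rat>" "3 * r / 2 < q" "q < 2 * r"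
    using Rats_dense_in_real[of "3 * r / 2" "2 * r"] cr by auto
  have q0: "0 < q" using q cr by simp
  have sub: "ball c r \<subseteq> ball d q"
  proof
    fix z assume "z \<in> ball c r"
    then show "z \<in> ball d q"
      using d q dist_triangle[of d z c] by (simp add: dist_commute)
  qed
  define v where "v = unit_ball_vol (DIM('a)) * r ^ DIM('a)"
  define v' where "v' = unit_ball_vol (DIM('a)) * q ^ DIM('a)"
  have v: "0 < v" "0 < v'" using cr q0 by (auto simp: v_def v'_def)
  have "q ^ DIM('a) \<le> (2 * r) ^ DIM('a)" using q q0 by (intro power_mono) auto
  then have v'v: "v' \<le> 2 ^ DIM('a) * v"
    by (simp add: v_def v'_def power_mult_distrib mult.left_commute mult_left_mono)
  define I where "I = (\<integral>\<^sup>+ y\<in>ball d q. f y \<partial>lebesgue)"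
  have "(\<integral>\<^sup>+ y\<in>ball c r. f y \<partial>lebesgue) \<le> I"
    unfolding I_def using sub by (intro nn_integral_mono mult_left_mono) (auto simp: indicator_def)
  then have "(\<integral>\<^sup>+ y\<in>ball c r. f y \<partial>lebesgue) / emeasure lebesgue (ball c r) \<le> I * ennreal (1 / v)"
    unfolding emeasure_lebesgue_ball[OF cr(1)] v_def[symmetric] using v
    by (simp add: divide_ennreal_def inverse_ennreal inverse_eq_divide mult_right_mono)
  also have "\<dots> \<le> I * ennreal (2 ^ DIM('a) * (1 / v'))"
    using v v'v by (intro mult_left_mono ennreal_leI) (auto simp: field_simps)
  also have "\<dots> = ennreal (2 ^ DIM('a)) * (I / ennreal v')"
    using v ennreal_mult[of "2 ^ DIM('a)" "1 / v'"]
    by (simp add: divide_ennreal_def inverse_ennreal inverse_eq_divide mult_ac)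
  also have "ennreal v' = emeasure lebesgue (ball d q)"
    unfolding emeasure_lebesgue_ball[OF q0] v'_def ..
  finally have "s < ennreal (2 ^ DIM('a)) * (I / emeasure lebesgue (ball d q))"
    using cr(3) by (rule less_le_trans[rotated])
  then show ?thesis
    using that[OF d(1) q(1) q0] cr(2) sub by (auto simp: I_def)
qed

text \<open>As \<open>\<phi> x\<close> may jump at \<open>m\<close>, its value there is not
  controlled by those below; evaluating at half of \<open>m\<close> leaves strict room, whence the 2
  in \<open>c / (2 * N)\<close>. If \<open>m = top\<close>, then \<open>R\<close> bounds
  \<open>\<phi> x\<close> everywhere, and its growth to infinity forces
  \<open>R = top\<close>.\<close>

lemma phi_ext_le:
  assumes reg: "1 < p" "1 \<le> a" "0 < b" "b \<le> 1" "regular_Phi p a b (\<phi> x)"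
    and c: "0 < c" and N: "0 < N"
    and ex: "\<And>s. s < m \<Longrightarrow> \<exists>A\<ge>0. s < ennreal (N * A) \<and> \<phi> x (c * A) \<le> R"
  shows "phi_ext \<phi> x (ennreal (c / (2 * N)) * m) \<le> R"
proof -
  have step: "\<phi> x (c / N * s) \<le> R" if "ennreal s < m" "0 \<le> s" for s
  proof -
    obtain A where A: "0 \<le> A" "ennreal s < ennreal (N * A)" "\<phi> x (c * A) \<le> R"
      using ex[OF \<open>ennreal s < m\<close>] by blast
    have "s < N * A" using A(2) that(2) by (simp add: ennreal_less_iff)
    then have "c / N * s \<le> c * A"
      using c N by (simp add: field_simps)
    then have "\<phi> x (c / N * s) \<le> \<phi> x (c * A)"
      using c N that by (intro regular_mono[OF reg]) auto
    then show ?thesis using A(3) by (rule order_trans)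
  qed
  show ?thesis
  proof (cases m)
    case (real r)
    show ?thesis
    proof (cases "r = 0")
      case True
      then show ?thesis by (simp add: real phi_ext_def regular_0[OF reg])
    next
      case False
      then have "\<phi> x (c / N * (r / 2)) \<le> R"
        using real by (intro step) (auto simp: ennreal_less_iff)
      moreover have "ennreal (c / (2 * N)) * m = ennreal (c / N * (r / 2))"
        using real c N by (simp add: ennreal_mult[symmetric])
      ultimately show ?thesis using c N real by (simp add: phi_ext_def)
    qed
  next
    case top
    have "R = top"
    proof (rule ccontr)
      assume "R \<noteq> top"
      then have "R < \<infinity>" by (simp add: less_top)
      moreover have "(\<phi> x \<longlongrightarrow> \<infinity>) at_top" using reg by (simp add: regular_Phi_def)
      ultimately have "\<forall>\<^sub>F t in at_top. R < \<phi> x t" by (simp add: order_tendstoD)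
      then obtain t0 where t0: "\<And>t. t0 \<le> t \<Longrightarrow> R < \<phi> x t" by (auto simp: eventually_at_top_linorder)
      have "\<phi> x (c / N * (N / c * max t0 0)) \<le> R"
        using c N by (intro step) (auto simp: top)
      then show False using t0[of "max t0 0"] c N by simp
    qed
    then show ?thesis by simp
  qed
qed

lemma phi_ext_scale:
  assumes reg: "1 < p" "1 \<le> a" "0 < b" "b \<le> 1" "regular_Phi p a b (\<phi> x)"
    and e: "0 < e" "e \<le> 1"
  shows "phi_ext \<phi> x (ennreal e * v) \<le> ennreal (a * e powr p) * phi_ext \<phi> x v"
proof (cases v)
  case (real r)
  then show ?thesis
    using regular_scale[OF reg e, of r] e by (simp add: phi_ext_def ennreal_mult[symmetric])
next
  case top
  then show ?thesis using e reg(2) by (simp add: phi_ext_def)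
qed

text \<open>The average over a ball is a lower bound for the maximal function at each of its points.
  For \<open>u\<close> this yields the bound by a constant over \<open>\<omega> B\<close> that (A1)
  calls for.\<close>

lemma average_maxop_bound:
  fixes \<omega> :: "'a::euclidean_space \<Rightarrow> real"
  assumes w: "is_weight \<omega>" and r: "0 < r" and p: "0 < p"
    and K: "(\<integral>\<^sup>+ x. epowr (maxop lebesgue u x) p * ennreal (\<omega> x) \<partial>lebesgue) \<le> K"
  shows "epowr ((\<integral>\<^sup>+ y\<in>ball c r. u y \<partial>lebesgue) / emeasure lebesgue (ball c r)) p * wmeas \<omega> (ball c r) \<le> K"
proof -
  let ?V = "(\<integral>\<^sup>+ y\<in>ball c r. u y \<partial>lebesgue) / emeasure lebesgue (ball c r)"
  have [measurable]: "\<omega> \<in> borel_measurable lebesgue" "ball c r \<in> sets lebesgue"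
    using borel_measurable_is_weight[OF w] by auto
  have "epowr ?V p * wmeas \<omega> (ball c r) = (\<integral>\<^sup>+ x. epowr ?V p * (ennreal (\<omega> x) * indicator (ball c r) x) \<partial>lebesgue)"
    unfolding wmeas_def by (rule nn_integral_cmult[symmetric]) measurable
  also have "\<dots> \<le> (\<integral>\<^sup>+ x. epowr (maxop lebesgue u x) p * ennreal (\<omega> x) \<partial>lebesgue)"
  proof (rule nn_integral_mono)
    fix x
    show "epowr ?V p * (ennreal (\<omega> x) * indicator (ball c r) x) \<le> epowr (maxop lebesgue u x) p * ennreal (\<omega> x)"
    proof (cases "x \<in> ball c r")
      case True
      have "epowr ?V p \<le> epowr (maxop lebesgue u x) p"
        using p by (intro epowr_mono maxop_upper r True) simp
      with True show ?thesis by (simp add: mult_right_mono del: mem_ball)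
    qed simp
  qed
  finally show ?thesis using K by (rule order_trans)
qed

lemma nn_integral_ball_eq_average:
  fixes f :: "'a::euclidean_space \<Rightarrow> ennreal"
  assumes r: "0 < r" and fin: "(\<integral>\<^sup>+ y\<in>ball c r. f y \<partial>lebesgue) < top"
  obtains A where "0 \<le> A" "(\<integral>\<^sup>+ y\<in>ball c r. f y \<partial>lebesgue) = ennreal A * emeasure lebesgue (ball c r)"
proof -
  let ?I = "\<integral>\<^sup>+ y\<in>ball c r. f y \<partial>lebesgue"
  define v where "v = unit_ball_vol (DIM('a)) * r ^ DIM('a)"
  have v: "0 < v" "emeasure lebesgue (ball c r) = ennreal v"
    using r by (auto simp: v_def emeasure_ball)
  have "?I = ennreal (enn2real ?I / v) * emeasure lebesgue (ball c r)"
    unfolding v(2) using fin v(1) by (simp flip: ennreal_mult)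
  then show ?thesis using v(1) by (intro that[of "enn2real ?I / v"]) auto
qed

section \<open>The conditions on \<open>\<phi>\<close> as statements about almost every
  point\<close>

lemma Phi_w_AE_regular:
  assumes "open \<Omega>" "Phi_w \<Omega> \<phi>" "A0 \<Omega> \<phi>" "aInc p \<Omega> \<phi>"
  obtains a b where "1 \<le> a" "0 < b" "b \<le> 1"
    "AE x in lebesgue. x \<in> \<Omega> \<longrightarrow> regular_Phi p a b (\<phi> x)"
proof -
  have \<Omega>: "\<Omega> \<inter> space lebesgue \<in> sets lebesgue" using assms(1) by simp
  obtain a where a: "1 \<le> a" "AE x in lebesgue_on \<Omega>. \<forall>s t. 0 < s \<and> s < t \<longrightarrow>
       \<phi> x s * ennreal (t powr p) \<le> ennreal a * \<phi> x t * ennreal (s powr p)"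
    using assms(4) unfolding aInc_def by blast
  obtain b where b: "0 < b" "b \<le> 1" "AE x in lebesgue_on \<Omega>. \<phi> x b \<le> 1 \<and> 1 \<le> \<phi> x (1 / b)"
    using assms(3) unfolding A0_def by blast
  have "AE x in lebesgue_on \<Omega>. mono_on {0..} (\<phi> x) \<and> \<phi> x 0 = 0 \<and>
        (\<phi> x \<longlongrightarrow> 0) (at_right 0) \<and> (\<phi> x \<longlongrightarrow> \<infinity>) at_top"
    using assms(2) unfolding Phi_w_def Phi_prefunction_def by blast
  with a(2) b(3) have "AE x in lebesgue_on \<Omega>. regular_Phi p a b (\<phi> x)"
    by eventually_elim (auto simp: regular_Phi_def)
  then have "AE x in lebesgue. x \<in> \<Omega> \<longrightarrow> regular_Phi p a b (\<phi> x)"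
    by (simp only: AE_restrict_space_iff[OF \<Omega>])
  then show ?thesis by (rule that[OF a(1) b(1,2)])
qed

lemma A1_AE:
  assumes \<Omega>: "open \<Omega>" and "A1 \<omega> \<Omega> \<phi>" and Q: "countable Q" "\<And>c r. (c, r) \<in> Q \<Longrightarrow> 0 < r"
  obtains \<beta> where "0 < \<beta>" "\<beta> \<le> 1"
    "AE x in lebesgue. \<forall>(c, r)\<in>Q. x \<in> ball c r \<inter> \<Omega> \<longrightarrow> (AE y in lebesgue. y \<in> ball c r \<inter> \<Omega> \<longrightarrow>
      (\<forall>t\<ge>0. 1 \<le> \<phi> y t \<and> \<phi> y t \<le> 1 / wmeas \<omega> (ball c r) \<longrightarrow> \<phi> x (\<beta> * t) \<le> \<phi> y t))"
proof -
  obtain \<beta> where \<beta>: "0 < \<beta>" "\<beta> \<le> 1" and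
    *: "\<And>c r. 0 < r \<Longrightarrow> wmeas \<omega> (ball c r) \<le> 1 \<Longrightarrow>
        (AE x in lebesgue_on (ball c r \<inter> \<Omega>). AE y in lebesgue_on (ball c r \<inter> \<Omega>).
           \<forall>t\<ge>0. 1 \<le> \<phi> y t \<and> \<phi> y t \<le> 1 / wmeas \<omega> (ball c r) \<longrightarrow> \<phi> x (\<beta> * t) \<le> \<phi> y t)"
    using assms(2) unfolding A1_def by blast
  have "AE x in lebesgue. x \<in> ball c r \<inter> \<Omega> \<longrightarrow> (AE y in lebesgue. y \<in> ball c r \<inter> \<Omega> \<longrightarrow>
      (\<forall>t\<ge>0. 1 \<le> \<phi> y t \<and> \<phi> y t \<le> 1 / wmeas \<omega> (ball c r) \<longrightarrow> \<phi> x (\<beta> * t) \<le> \<phi> y t))"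
    if "(c, r) \<in> Q" for c r
  proof (cases "wmeas \<omega> (ball c r) \<le> 1")
    case True
    have s: "(ball c r \<inter> \<Omega>) \<inter> space lebesgue \<in> sets lebesgue" using \<Omega> by simp
    show ?thesis
      using *[OF Q(2)[OF that] True] by (simp only: AE_restrict_space_iff[OF s])
  next
    case False
    then have "wmeas \<omega> (ball c r) \<noteq> 0" "1 < wmeas \<omega> (ball c r)" by auto
    then have "1 / wmeas \<omega> (ball c r) < 1"
      by (cases "wmeas \<omega> (ball c r) = top") (simp_all add: divide_less_ennreal less_top)
    then have "\<not> (1 \<le> \<phi> y t \<and> \<phi> y t \<le> 1 / wmeas \<omega> (ball c r))" for y t
      using leD order_trans by blast
    then show ?thesis by (intro AE_I2 impI) blast
  qed
  then have "AE x in lebesgue. \<forall>i\<in>Q. x \<in> ball (fst i) (snd i) \<inter> \<Omega> \<longrightarrow> (AE y in lebesgue. y \<in> ball (fst i) (snd i) \<inter> \<Omega> \<longrightarrow>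
      (\<forall>t\<ge>0. 1 \<le> \<phi> y t \<and> \<phi> y t \<le> 1 / wmeas \<omega> (ball (fst i) (snd i)) \<longrightarrow> \<phi> x (\<beta> * t) \<le> \<phi> y t))"
    by (intro AE_ball_countable[OF Q(1), THEN iffD2] ballI) auto
  then show ?thesis
    by (intro that[OF \<beta>]) (simp only: case_prod_beta')
qed

text \<open>(A2) is taken at \<open>s = 1\<close>, as it is applied only at arguments up to
  \<open>b\<close>, where (A0) gives values at most 1.\<close>

lemma A2_AE:
  assumes \<Omega>: "open \<Omega>" and "A2 \<omega> \<Omega> \<phi>"
  obtains \<beta> h where "0 < \<beta>" "\<beta> \<le> 1" "\<And>x. 0 \<le> h x" "h \<in> borel_measurable (lebesgue_on \<Omega>)"
    "(\<integral>\<^sup>+ x\<in>\<Omega>. ennreal (h x * \<omega> x) \<partial>lebesgue) < \<infinity>"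
    "AE x in lebesgue. x \<in> \<Omega> \<longrightarrow> (AE y in lebesgue. y \<in> \<Omega> \<longrightarrow>
      (\<forall>t\<ge>0. \<phi> y t \<le> 1 \<longrightarrow> \<phi> x (\<beta> * t) \<le> \<phi> y t + ennreal (h x) + ennreal (h y)))"
proof -
  have s: "\<Omega> \<inter> space lebesgue \<in> sets lebesgue" using \<Omega> by simp
  obtain \<beta> h where *: "0 < \<beta>" "\<beta> \<le> 1" "\<forall>x. 0 \<le> h x" "h \<in> borel_measurable (lebesgue_on \<Omega>)"
    "(\<integral>\<^sup>+ x\<in>\<Omega>. ennreal (h x * \<omega> x) \<partial>lebesgue) < \<infinity>"
    "AE x in lebesgue_on \<Omega>. AE y in lebesgue_on \<Omega>.
        \<forall>t\<ge>0. \<phi> y t \<le> ennreal 1 \<longrightarrow> \<phi> x (\<beta> * t) \<le> \<phi> y t + ennreal (h x) + ennreal (h y)"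
    using assms(2)[unfolded A2_def, rule_format, OF zero_less_one] by blast
  show ?thesis
    using * by (intro that[of \<beta> h]) (simp_all only: AE_restrict_space_iff[OF s] ennreal_1)
qed

text \<open>\<open>c\<close>, \<open>K\<close> and \<open>h\<close> are fixed before
  \<open>g\<close>. The modular bound on \<open>g\<close> enters through \<open>maxu\<close>, which
  puts the \<open>p\<close>-th power of every average of \<open>u\<close> below \<open>K0\<close>
  over the weight of the ball.\<close>

lemma maximal_pointwise_estimate:
  fixes \<Omega> :: "'a::euclidean_space set"
  assumes \<Omega>: "open \<Omega>" and p: "1 < p" and A: "Muckenhoupt p \<omega>"
    and \<phi>: "Phi_w \<Omega> \<phi>" "A0 \<Omega> \<phi>" "A1 \<omega> \<Omega> \<phi>" "A2 \<omega> \<Omega> \<phi>" "aInc p \<Omega> \<phi>"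
  obtains c K h where "0 < c" "0 < K" "\<And>x. 0 \<le> h x" "h \<in> borel_measurable (lebesgue_on \<Omega>)"
    "(\<integral>\<^sup>+ x\<in>\<Omega>. ennreal (h x * \<omega> x) \<partial>lebesgue) < \<infinity>"
    "\<And>g. g \<in> borel_measurable (lebesgue_on \<Omega>) \<Longrightarrow> wmodular \<phi> \<omega> \<Omega> (\<lambda>x. ennreal \<bar>g x\<bar>) \<le> 1 \<Longrightarrow>
      AE x in lebesgue. x \<in> \<Omega> \<longrightarrow> phi_ext \<phi> x (ennreal c * maximal \<Omega> g x) \<le> ennreal K *
       (epowr (maxop lebesgue (\<lambda>y. epowr (\<phi> y \<bar>g y\<bar> * indicator \<Omega> y) (1 / p)) x) p + ennreal (h x)
        + epowr (maxop lebesgue (\<lambda>y. epowr (ennreal (h y) * indicator \<Omega> y) (1 / p)) x) p)"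
proof -
  have w: "is_weight \<omega>" using A by (simp add: Muckenhoupt_def)
  have \<Omega>s: "\<Omega> \<inter> space lebesgue \<in> sets lebesgue" using \<Omega> by simp
  have [measurable]: "\<Omega> \<in> sets lebesgue" using \<Omega> by simp
  obtain a b where ab: "1 \<le> a" "0 < b" "b \<le> 1"
    and reg: "AE x in lebesgue. x \<in> \<Omega> \<longrightarrow> regular_Phi p a b (\<phi> x)"
    by (rule Phi_w_AE_regular[OF \<Omega> \<phi>(1,2,5)])
  note rg = p ab
  obtain D :: "'a set" where D: "countable D" "\<And>X. open X \<Longrightarrow> X \<noteq> {} \<Longrightarrow> \<exists>d\<in>D. d \<in> X"
    by (rule countable_dense_setE) blast
  define Q where "Q = D \<times> {r \<in> \<rat>. (0::real) < r}"
  have Q: "countable Q" "\<And>c r. (c, r) \<in> Q \<Longrightarrow> 0 < r"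
    using D(1) countable_subset[of "{r \<in> \<rat>. (0::real) < r}" \<rat>] by (auto simp: Q_def countable_rat)
  obtain \<beta>1 where \<beta>1: "0 < \<beta>1" "\<beta>1 \<le> 1"
    and a1: "AE x in lebesgue. \<forall>(c, r)\<in>Q. x \<in> ball c r \<inter> \<Omega> \<longrightarrow> (AE y in lebesgue. y \<in> ball c r \<inter> \<Omega> \<longrightarrow>
      (\<forall>t\<ge>0. 1 \<le> \<phi> y t \<and> \<phi> y t \<le> 1 / wmeas \<omega> (ball c r) \<longrightarrow> \<phi> x (\<beta>1 * t) \<le> \<phi> y t))"
    by (rule A1_AE[OF \<Omega> \<phi>(3) Q]) auto
  obtain \<beta>2 h where \<beta>2: "0 < \<beta>2" "\<beta>2 \<le> 1" and h: "\<And>x. 0 \<le> h x" "h \<in> borel_measurable (lebesgue_on \<Omega>)"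
    "(\<integral>\<^sup>+ x\<in>\<Omega>. ennreal (h x * \<omega> x) \<partial>lebesgue) < \<infinity>"
    and a2: "AE x in lebesgue. x \<in> \<Omega> \<longrightarrow> (AE y in lebesgue. y \<in> \<Omega> \<longrightarrow>
      (\<forall>t\<ge>0. \<phi> y t \<le> 1 \<longrightarrow> \<phi> x (\<beta>2 * t) \<le> \<phi> y t + ennreal (h x) + ennreal (h y)))"
    by (rule A2_AE[OF \<Omega> \<phi>(4)]) blast
  obtain K0 where K0: "0 < K0" "\<And>f. f \<in> borel_measurable lebesgue \<Longrightarrow>
    (\<integral>\<^sup>+ x. epowr (maxop lebesgue f x) p * ennreal (\<omega> x) \<partial>lebesgue)
      \<le> ennreal K0 * (\<integral>\<^sup>+ x. epowr (f x) p * ennreal (\<omega> x) \<partial>lebesgue)"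
    by (rule Muckenhoupt_maximal[OF A p]) blast
  obtain c1 K1 where c1: "0 < c1" "0 < K1" and large:
    "\<And>M B W A \<psi> (\<phi> :: 'a \<Rightarrow> real \<Rightarrow> ennreal) f u.
      \<lbrakk>B \<in> sets M; 0 < emeasure M B; emeasure M B < top; 0 \<le> A; 0 < W;
       f \<in> borel_measurable M; u \<in> borel_measurable M;
       (\<integral>\<^sup>+ y\<in>B. ennreal (f y) \<partial>M) = ennreal A * emeasure M B;
       epowr ((\<integral>\<^sup>+ y\<in>B. u y \<partial>M) / emeasure M B) p * ennreal W \<le> ennreal K0;
       regular_Phi p a b \<psi>;
       AE y in M. y \<in> B \<longrightarrow> f y = 0 \<or> 1 / b < f y \<and> regular_Phi p a b (\<phi> y) \<and>
         u y = epowr (\<phi> y (f y)) (1 / p) \<and>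
         (\<forall>t\<ge>0. 1 \<le> \<phi> y t \<and> \<phi> y t \<le> 1 / ennreal W \<longrightarrow> \<psi> (\<beta>1 * t) \<le> \<phi> y t)\<rbrakk>
      \<Longrightarrow> \<psi> (c1 * A) \<le> ennreal K1 * epowr ((\<integral>\<^sup>+ y\<in>B. u y \<partial>M) / emeasure M B) p"
    by (rule large_part_estimate[OF p ab K0(1) \<beta>1(1)]) blast
  \<comment> \<open>Multiplication by \<open>b\<^sup>2\<close> takes values up to
    \<open>1 / b\<close> to values up to \<open>b\<close>, where \<open>\<phi> y\<close> is at most
    1 and (A2) applies.\<close>
  define \<gamma> where "\<gamma> = \<beta>2 * b\<^sup>2"
  have b2: "b\<^sup>2 \<le> 1" "0 < b\<^sup>2" using ab by (auto simp: power_le_one)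
  have \<gamma>: "0 < \<gamma>" using \<beta>2 b2 by (simp add: \<gamma>_def)
  \<comment> \<open>\<open>\<phi> x\<close> need not be subadditive, so \<open>A1 + A2\<close> is
    bounded by twice the larger of the two averages; half of the minimum serves in either
    case.\<close>
  define c0 where "c0 = min c1 (\<gamma> / 2) / 2"
  have c0: "0 < c0" "2 * c0 \<le> c1" "2 * c0 \<le> \<gamma> / 2" using c1 \<gamma> by (auto simp: c0_def)
  define K3 where "K3 = K1 + 16 powr p * a"
  have K3: "0 < K3" using c1 ab by (auto simp: K3_def intro!: add_pos_nonneg)
  let ?N = "2 ^ DIM('a) :: real"
  define k where "k y = epowr (ennreal (h y) * indicator \<Omega> y) (1 / p)" for y
  have "(\<lambda>y. ennreal (h y)) \<in> borel_measurable (lebesgue_on \<Omega>)"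
    using h(2) by measurable
  then have [measurable]: "(\<lambda>y. ennreal (h y) * indicator \<Omega> y) \<in> borel_measurable lebesgue"
    by (simp only: borel_measurable_restrict_space_iff_ennreal[OF \<Omega>s])
  have km [measurable]: "k \<in> borel_measurable lebesgue"
    unfolding k_def[abs_def] by measurable
  have kp: "epowr (k y) p = ennreal (h y)" if "y \<in> \<Omega>" for y
    using that p by (simp add: k_def epowr_epowr)
  show ?thesis
  proof (rule that[of "c0 / (2 * ?N)" K3 h])
    show "0 < c0 / (2 * ?N)" using c0 by simp
    show "0 < K3" by (rule K3)
    show "\<And>x. 0 \<le> h x" "h \<in> borel_measurable (lebesgue_on \<Omega>)"
      "(\<integral>\<^sup>+ x\<in>\<Omega>. ennreal (h x * \<omega> x) \<partial>lebesgue) < \<infinity>" by (fact h)+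
    fix g :: "'a \<Rightarrow> real"
    assume g [measurable]: "g \<in> borel_measurable (lebesgue_on \<Omega>)"
      and mod: "wmodular \<phi> \<omega> \<Omega> (\<lambda>x. ennreal \<bar>g x\<bar>) \<le> 1"
    define u where "u y = epowr (\<phi> y \<bar>g y\<bar> * indicator \<Omega> y) (1 / p)" for y
    define G where "G y = indicator \<Omega> y * \<bar>g y\<bar>" for y
    define f1 where "f1 y = (if 1 / b < G y then G y else 0)" for y
    define f2 where "f2 y = (if 1 / b < G y then 0 else G y)" for y
    have "(\<lambda>x. \<phi> x \<bar>g x\<bar>) \<in> borel_measurable (lebesgue_on \<Omega>)"
      using \<phi>(1) g unfolding Phi_w_def Phi_prefunction_def by blast
    then have [measurable]: "(\<lambda>x. \<phi> x \<bar>g x\<bar> * indicator \<Omega> x) \<in> borel_measurable lebesgue"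
      by (simp only: borel_measurable_restrict_space_iff_ennreal[OF \<Omega>s])
    have um [measurable]: "u \<in> borel_measurable lebesgue"
      unfolding u_def[abs_def] by measurable
    have "(\<lambda>x. \<bar>g x\<bar>) \<in> borel_measurable (lebesgue_on \<Omega>)" by measurable
    then have [measurable]: "G \<in> borel_measurable lebesgue"
      using borel_measurable_restrict_space_iff[OF \<Omega>s, of "\<lambda>x. \<bar>g x\<bar>"] by (simp add: G_def[abs_def])
    have f1m [measurable]: "f1 \<in> borel_measurable lebesgue" and f2m [measurable]: "f2 \<in> borel_measurable lebesgue"
      unfolding f1_def[abs_def] f2_def[abs_def] by measurable
    have G0: "0 \<le> G y" for y by (simp add: G_def)
    have f0: "0 \<le> f1 y" "0 \<le> f2 y" "f1 y + f2 y = G y" "f2 y \<le> 1 / b" for y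
      using G0[of y] ab by (auto simp: f1_def f2_def)
    have up: "epowr (u y) p = \<phi> y \<bar>g y\<bar>" if "y \<in> \<Omega>" for y
      using that p by (simp add: u_def epowr_epowr)
    have "(\<integral>\<^sup>+ x. epowr (u x) p * ennreal (\<omega> x) \<partial>lebesgue) = wmodular \<phi> \<omega> \<Omega> (\<lambda>x. ennreal \<bar>g x\<bar>)"
      unfolding wmodular_def using p
      by (intro nn_integral_cong) (auto simp: u_def epowr_epowr phi_ext_def indicator_def)
    then have maxu: "(\<integral>\<^sup>+ x. epowr (maxop lebesgue u x) p * ennreal (\<omega> x) \<partial>lebesgue) \<le> ennreal K0"
      using K0(2)[OF um] mod mult_left_mono[OF mod, of "ennreal K0"] by (auto intro: order_trans)
    define R where "R x = ennreal K3 * (epowr (maxop lebesgue u x) p + ennreal (h x) + epowr (maxop lebesgue k x) p)" for x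
    have "AE x in lebesgue. x \<in> \<Omega> \<longrightarrow> phi_ext \<phi> x (ennreal (c0 / (2 * ?N)) * maximal \<Omega> g x) \<le> R x"
      using reg a1 a2
    proof eventually_elim
      case (elim x)
      show ?case
      proof
        assume x: "x \<in> \<Omega>"
        with elim have rx: "regular_Phi p a b (\<phi> x)" by simp
        \<comment> \<open>With \<open>x\<close> fixed, the null set of points \<open>y\<close> may
          depend on \<open>x\<close> and on the ball, since it only enters integrals over
          \<open>y\<close>.\<close>
        have a1x: "AE y in lebesgue. y \<in> ball c r \<inter> \<Omega> \<longrightarrow>
          (\<forall>t\<ge>0. 1 \<le> \<phi> y t \<and> \<phi> y t \<le> 1 / wmeas \<omega> (ball c r) \<longrightarrow> \<phi> x (\<beta>1 * t) \<le> \<phi> y t)"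
          if "(c, r) \<in> Q" "x \<in> ball c r" for c r
          using elim x that by blast
        have a2x: "AE y in lebesgue. y \<in> \<Omega> \<longrightarrow>
          (\<forall>t\<ge>0. \<phi> y t \<le> 1 \<longrightarrow> \<phi> x (\<beta>2 * t) \<le> \<phi> y t + ennreal (h x) + ennreal (h y))"
          using elim x by blast
        have ball: "\<exists>A\<ge>0. (\<integral>\<^sup>+ y\<in>ball c r. ennreal (G y) \<partial>lebesgue) / emeasure lebesgue (ball c r) = ennreal A
            \<and> \<phi> x (c0 * A) \<le> R x"
          if cr: "(c, r) \<in> Q" "x \<in> ball c r" for c r
        proof -
          have r: "0 < r" by (rule Q(2)[OF cr(1)])
          let ?B = "ball c r"
          let ?V = "(\<integral>\<^sup>+ y\<in>?B. u y \<partial>lebesgue) / emeasure lebesgue ?B"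
          have Bm [measurable]: "?B \<in> sets lebesgue" by simp
          have B: "0 < emeasure lebesgue ?B" "emeasure lebesgue ?B < top"
            using emeasure_lebesgue_ball[OF r, of c] r by auto
          have VW: "epowr ?V p * wmeas \<omega> ?B \<le> ennreal K0"
            using p by (intro average_maxop_bound[OF w r _ maxu]) simp
          \<comment> \<open>Positivity and finiteness of the weight of a ball are part of
            \<open>doubling\<close>. With them, \<open>VW\<close> forces the average of
            \<open>u\<close> to be finite.\<close>
          obtain W where W: "0 < W" "wmeas \<omega> ?B = ennreal W"
          proof -
            obtain D where "doubling D (weight_measure \<omega>)"
              using Muckenhoupt_doubling[OF A p] by blast
            then have "0 < wmeas \<omega> ?B" "wmeas \<omega> ?B < top"
              unfolding doubling_def emeasure_weight_measure[OF w Bm, symmetric] using r by blast+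
            then show ?thesis by (intro that[of "enn2real (wmeas \<omega> ?B)"]) (auto simp: enn2real_positive_iff)
          qed
          have "?V \<noteq> top"
            using VW W by (auto simp: top_unique)
          then have ufin: "(\<integral>\<^sup>+ y\<in>?B. u y \<partial>lebesgue) \<noteq> top"
            using B by (auto simp: ennreal_divide_eq_top_iff)
          \<comment> \<open>The average of \<open>f1\<close> is a real number only if its integral
            is finite; this follows from domination by a multiple of \<open>u\<close>.\<close>
          have "(\<integral>\<^sup>+ y\<in>?B. ennreal (f1 y) \<partial>lebesgue) \<le> (\<integral>\<^sup>+ y. ennreal (a powr (1 / p) / b) * (u y * indicator ?B y) \<partial>lebesgue)"
          proof (rule nn_integral_mono_AE)
            show "AE y in lebesgue. ennreal (f1 y) * indicator ?B y \<le> ennreal (a powr (1 / p) / b) * (u y * indicator ?B y)"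
              using reg
            proof eventually_elim
              case (elim y)
              show ?case
              proof (cases "f1 y = 0")
                case False
                then have y: "y \<in> \<Omega>" "f1 y = \<bar>g y\<bar>" "1 / b < \<bar>g y\<bar>"
                  using ab by (auto simp: f1_def G_def indicator_def split: if_splits)
                have "ennreal (f1 y) = ennreal (1 / b) * ennreal (b * \<bar>g y\<bar>)"
                  using y ab by (simp flip: ennreal_mult)
                also have "\<dots> \<le> ennreal (1 / b) * (ennreal (a powr (1 / p)) * epowr (\<phi> y \<bar>g y\<bar>) (1 / p))"
                  using elim y by (intro mult_left_mono regular_ge[OF rg]) auto
                also have "\<dots> = ennreal (a powr (1 / p) / b) * u y"
                  using y ab ennreal_mult[of "1 / b" "a powr (1 / p)"] by (simp add: u_def mult.assoc[symmetric])
                finally have "ennreal (f1 y) \<le> ennreal (a powr (1 / p) / b) * u y" .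
                then show ?thesis by (auto simp: indicator_def)
              qed simp
            qed
          qed
          also have "\<dots> = ennreal (a powr (1 / p) / b) * (\<integral>\<^sup>+ y\<in>?B. u y \<partial>lebesgue)"
            by (rule nn_integral_cmult) measurable
          also have "\<dots> < top" using ufin by (simp add: ennreal_mult_less_top less_top)
          finally obtain A1 where A1: "0 \<le> A1"
            "(\<integral>\<^sup>+ y\<in>?B. ennreal (f1 y) \<partial>lebesgue) = ennreal A1 * emeasure lebesgue ?B"
            by (rule nn_integral_ball_eq_average[OF r])
          have "(\<integral>\<^sup>+ y\<in>?B. ennreal (f2 y) \<partial>lebesgue) \<le> (\<integral>\<^sup>+ y\<in>?B. ennreal (1 / b) \<partial>lebesgue)"
            using f0 by (intro nn_integral_mono mult_right_mono ennreal_leI) auto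
          also have "\<dots> = ennreal (1 / b) * emeasure lebesgue ?B"
            by (rule nn_integral_cmult_indicator) simp
          also have "\<dots> < top" using B by (simp add: ennreal_mult_less_top)
          finally obtain A2 where A2: "0 \<le> A2"
            "(\<integral>\<^sup>+ y\<in>?B. ennreal (f2 y) \<partial>lebesgue) = ennreal A2 * emeasure lebesgue ?B"
            by (rule nn_integral_ball_eq_average[OF r])
          have "(\<integral>\<^sup>+ y\<in>?B. ennreal (G y) \<partial>lebesgue) =
              (\<integral>\<^sup>+ y. ennreal (f1 y) * indicator ?B y + ennreal (f2 y) * indicator ?B y \<partial>lebesgue)"
            using f0 by (intro nn_integral_cong) (simp add: distrib_right[symmetric] flip: ennreal_plus)
          also have "\<dots> = (\<integral>\<^sup>+ y\<in>?B. ennreal (f1 y) \<partial>lebesgue) + (\<integral>\<^sup>+ y\<in>?B. ennreal (f2 y) \<partial>lebesgue)"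
            by (rule nn_integral_add) measurable
          also have "\<dots> = ennreal (A1 + A2) * emeasure lebesgue ?B"
            using A1 A2 by (simp add: distrib_right)
          finally have avg: "(\<integral>\<^sup>+ y\<in>?B. ennreal (G y) \<partial>lebesgue) / emeasure lebesgue ?B = ennreal (A1 + A2)"
            using B by (simp only: ennreal_mult_divide_eq)

          have "\<phi> x (c1 * A1) \<le> ennreal K1 * epowr ?V p"
          proof (rule large[where f = f1 and W = W and \<phi> = \<phi>])
            show "AE y in lebesgue. y \<in> ?B \<longrightarrow> f1 y = 0 \<or> 1 / b < f1 y \<and> regular_Phi p a b (\<phi> y) \<and>
              u y = epowr (\<phi> y (f1 y)) (1 / p) \<and>
              (\<forall>t\<ge>0. 1 \<le> \<phi> y t \<and> \<phi> y t \<le> 1 / ennreal W \<longrightarrow> \<phi> x (\<beta>1 * t) \<le> \<phi> y t)"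
              using reg a1x[OF cr] unfolding W(2)
            proof eventually_elim
              case (elim y)
              show ?case
              proof (intro impI)
                assume yB: "y \<in> ?B"
                show "f1 y = 0 \<or> 1 / b < f1 y \<and> regular_Phi p a b (\<phi> y) \<and>
                  u y = epowr (\<phi> y (f1 y)) (1 / p) \<and>
                  (\<forall>t\<ge>0. 1 \<le> \<phi> y t \<and> \<phi> y t \<le> 1 / ennreal W \<longrightarrow> \<phi> x (\<beta>1 * t) \<le> \<phi> y t)"
                proof (cases "f1 y = 0")
                  case False
                  then have y: "y \<in> \<Omega>" "f1 y = \<bar>g y\<bar>" "1 / b < \<bar>g y\<bar>"
                    using ab by (auto simp: f1_def G_def indicator_def split: if_splits)
                  then have "u y = epowr (\<phi> y (f1 y)) (1 / p)" by (simp add: u_def)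
                  moreover have "1 / b < f1 y" using y by simp
                  moreover have "regular_Phi p a b (\<phi> y)" using elim(1) y(1) by (rule mp)
                  moreover have "\<forall>t\<ge>0. 1 \<le> \<phi> y t \<and> \<phi> y t \<le> 1 / ennreal W \<longrightarrow> \<phi> x (\<beta>1 * t) \<le> \<phi> y t"
                    using elim(2) IntI[OF yB y(1)] by (rule mp)
                  ultimately show ?thesis by (intro disjI2 conjI)
                qed simp
              qed
            qed
          qed (use Bm B A1 W f1m um VW rx in \<open>simp_all only: W(2)[symmetric]\<close>)
          also have "\<dots> \<le> ennreal K1 * (epowr (maxop lebesgue u x) p + ennreal (h x) + epowr (maxop lebesgue k x) p)"
          proof (intro mult_left_mono)
            have "epowr ?V p \<le> epowr (maxop lebesgue u x) p"
              using p by (intro epowr_mono maxop_upper[OF r cr(2)]) simp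
            then show "epowr ?V p \<le> epowr (maxop lebesgue u x) p + ennreal (h x) + epowr (maxop lebesgue k x) p"
              by (simp add: add.assoc add_increasing2)
          qed simp
          finally have p1: "\<phi> x (c1 * A1) \<le> ennreal K1 * (epowr (maxop lebesgue u x) p + ennreal (h x) + epowr (maxop lebesgue k x) p)" .

          have "\<phi> x (\<gamma> / 2 * A2) \<le> ennreal (16 powr p * a) *
              (epowr ?V p + epowr (k x) p + epowr ((\<integral>\<^sup>+ y\<in>?B. k y \<partial>lebesgue) / emeasure lebesgue ?B) p)"
          \<comment> \<open>\<open>k x\<close> plays the role of the constant \<open>H\<close>, its
            \<open>p\<close>-th power being \<open>h x\<close>.\<close>
          proof (rule small_part_estimate[OF rg rx \<gamma> Bm B A2(1) f2m f0(2) um km A2(2)])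
            show "AE y in lebesgue. y \<in> ?B \<longrightarrow> f2 y = 0 \<or>
              \<phi> x (\<gamma> * f2 y) \<le> epowr (u y) p + epowr (k x) p + epowr (k y) p"
              using reg a2x
            proof eventually_elim
              case (elim y)
              show ?case
              proof (cases "f2 y = 0")
                case False
                then have y: "y \<in> \<Omega>" "f2 y = \<bar>g y\<bar>" "\<bar>g y\<bar> \<le> 1 / b"
                  using f0(4)[of y] by (auto simp: f2_def G_def indicator_def split: if_splits)
                have ry: "regular_Phi p a b (\<phi> y)" using elim y by simp
                have "b\<^sup>2 * \<bar>g y\<bar> \<le> b\<^sup>2 * (1 / b)" using y(3) by (intro mult_left_mono) auto
                also have "\<dots> = b" using ab by (simp add: power2_eq_square)
                finally have "\<phi> y (b\<^sup>2 * \<bar>g y\<bar>) \<le> \<phi> y b"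
                  by (intro regular_mono[OF rg ry]) auto
                also have "\<dots> \<le> 1" using ry by (simp add: regular_Phi_def)
                finally have le1: "\<phi> y (b\<^sup>2 * \<bar>g y\<bar>) \<le> 1" .
                have "\<phi> x (\<gamma> * f2 y) \<le> \<phi> y (b\<^sup>2 * \<bar>g y\<bar>) + ennreal (h x) + ennreal (h y)"
                  using elim y(1) le1 by (simp add: \<gamma>_def y(2) mult.assoc)
                also have "\<dots> \<le> \<phi> y \<bar>g y\<bar> + ennreal (h x) + ennreal (h y)"
                  using b2 by (intro add_right_mono regular_mono[OF rg ry] mult_left_le_one_le) auto
                finally show ?thesis using y(1) x by (simp add: up kp)
              qed simp
            qed
          qed
          also have "\<dots> \<le> ennreal (16 powr p * a) * (epowr (maxop lebesgue u x) p + ennreal (h x) + epowr (maxop lebesgue k x) p)"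
            unfolding kp[OF x] using p
            by (intro mult_left_mono add_mono epowr_mono maxop_upper[OF r cr(2)]) auto
          finally have p2: "\<phi> x (\<gamma> / 2 * A2) \<le> ennreal (16 powr p * a) * (epowr (maxop lebesgue u x) p + ennreal (h x) + epowr (maxop lebesgue k x) p)" .

          have R: "R x = ennreal K1 * (epowr (maxop lebesgue u x) p + ennreal (h x) + epowr (maxop lebesgue k x) p)
            + ennreal (16 powr p * a) * (epowr (maxop lebesgue u x) p + ennreal (h x) + epowr (maxop lebesgue k x) p)"
            using c1 ab by (simp add: R_def K3_def distrib_right)
          have "\<phi> x (c0 * (A1 + A2)) \<le> \<phi> x (c1 * A1) + \<phi> x (\<gamma> / 2 * A2)"
          proof (cases "A2 \<le> A1")
            case True
            have "c0 * (A1 + A2) \<le> c0 * (2 * A1)" using True c0 by (intro mult_left_mono) auto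
            also have "\<dots> \<le> c1 * A1" using c0 A1 mult_right_mono[of "2 * c0" c1 A1] by simp
            finally have "\<phi> x (c0 * (A1 + A2)) \<le> \<phi> x (c1 * A1)"
              using c0 A1 A2 by (intro regular_mono[OF rg rx]) auto
            then show ?thesis by (simp add: add_increasing2)
          next
            case False
            have "c0 * (A1 + A2) \<le> c0 * (2 * A2)" using False c0 by (intro mult_left_mono) auto
            also have "\<dots> \<le> \<gamma> / 2 * A2" using c0 A2 mult_right_mono[of "2 * c0" "\<gamma> / 2" A2] by simp
            finally have "\<phi> x (c0 * (A1 + A2)) \<le> \<phi> x (\<gamma> / 2 * A2)"
              using c0 A1 A2 by (intro regular_mono[OF rg rx]) auto
            then show ?thesis by (simp add: add_increasing)
          qed
          also have "\<dots> \<le> R x" unfolding R by (intro add_mono p1 p2)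
          finally show ?thesis
            using avg A1 A2 by (intro exI[of _ "A1 + A2"]) auto
        qed
        have max: "maximal \<Omega> g x = maxop lebesgue (\<lambda>y. ennreal (G y)) x"
          unfolding maximal_eq_maxop
          by (intro arg_cong[where f = "\<lambda>f. maxop lebesgue f x"]) (auto simp: G_def indicator_def)
        show "phi_ext \<phi> x (ennreal (c0 / (2 * ?N)) * maximal \<Omega> g x) \<le> R x"
        proof (rule phi_ext_le[where \<phi> = \<phi> and x = x, OF rg rx c0(1)])
          fix s assume "s < maximal \<Omega> g x"
          then have "s < maxop lebesgue (\<lambda>y. ennreal (G y)) x" unfolding max .
          from less_maxop_dense[OF D(2) this] obtain c r where cr: "c \<in> D" "r \<in> \<rat>" "0 < r" "x \<in> ball c r"
            "s < ennreal ?N * ((\<integral>\<^sup>+ y\<in>ball c r. ennreal (G y) \<partial>lebesgue) / emeasure lebesgue (ball c r))"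
            by blast
          then have "(c, r) \<in> Q" by (simp add: Q_def)
          from ball[OF this cr(4)] obtain A where "0 \<le> A" "\<phi> x (c0 * A) \<le> R x"
            "(\<integral>\<^sup>+ y\<in>ball c r. ennreal (G y) \<partial>lebesgue) / emeasure lebesgue (ball c r) = ennreal A" by blast
          with cr(5) show "\<exists>A\<ge>0. s < ennreal (?N * A) \<and> \<phi> x (c0 * A) \<le> R x"
            by (auto simp: ennreal_mult)
        qed simp
      qed
    qed
    then show "AE x in lebesgue. x \<in> \<Omega> \<longrightarrow> phi_ext \<phi> x (ennreal (c0 / (2 * ?N)) * maximal \<Omega> g x) \<le> ennreal K3 *
       (epowr (maxop lebesgue (\<lambda>y. epowr (\<phi> y \<bar>g y\<bar> * indicator \<Omega> y) (1 / p)) x) p + ennreal (h x)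
        + epowr (maxop lebesgue (\<lambda>y. epowr (ennreal (h y) * indicator \<Omega> y) (1 / p)) x) p)"
      unfolding R_def u_def[abs_def] k_def[abs_def] .
  qed
qed

section \<open>From the pointwise bound to modulars and norms\<close>

lemma wmodular_maximal_le_1:
  fixes \<Omega> :: "'a::euclidean_space set"
  assumes \<Omega>: "open \<Omega>" and p: "1 < p" and A: "Muckenhoupt p \<omega>"
    and \<phi>: "Phi_w \<Omega> \<phi>" "A0 \<Omega> \<phi>" "A1 \<omega> \<Omega> \<phi>" "A2 \<omega> \<Omega> \<phi>" "aInc p \<Omega> \<phi>"
  obtains c where "0 < c"
    "\<And>g. g \<in> borel_measurable (lebesgue_on \<Omega>) \<Longrightarrow> wmodular \<phi> \<omega> \<Omega> (\<lambda>x. ennreal \<bar>g x\<bar>) \<le> 1 \<Longrightarrow>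
      wmodular \<phi> \<omega> \<Omega> (\<lambda>x. ennreal c * maximal \<Omega> g x) \<le> 1"
proof -
  have w: "is_weight \<omega>" using A by (simp add: Muckenhoupt_def)
  have [measurable]: "\<omega> \<in> borel_measurable lebesgue" by (rule borel_measurable_is_weight[OF w])
  have \<Omega>s: "\<Omega> \<inter> space lebesgue \<in> sets lebesgue" using \<Omega> by simp
  have [measurable]: "\<Omega> \<in> sets lebesgue" using \<Omega> by simp
  obtain a b where ab: "1 \<le> a" "0 < b" "b \<le> 1"
    and reg: "AE x in lebesgue. x \<in> \<Omega> \<longrightarrow> regular_Phi p a b (\<phi> x)"
    by (rule Phi_w_AE_regular[OF \<Omega> \<phi>(1,2,5)])
  obtain K0 where K0: "0 < K0" "\<And>f. f \<in> borel_measurable lebesgue \<Longrightarrow>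
    (\<integral>\<^sup>+ x. epowr (maxop lebesgue f x) p * ennreal (\<omega> x) \<partial>lebesgue)
      \<le> ennreal K0 * (\<integral>\<^sup>+ x. epowr (f x) p * ennreal (\<omega> x) \<partial>lebesgue)"
    by (rule Muckenhoupt_maximal[OF A p]) blast
  obtain c K h where c: "0 < c" and K: "0 < K" and h: "\<And>x. 0 \<le> h x" "h \<in> borel_measurable (lebesgue_on \<Omega>)"
    "(\<integral>\<^sup>+ x\<in>\<Omega>. ennreal (h x * \<omega> x) \<partial>lebesgue) < \<infinity>"
    and pt: "\<And>g. g \<in> borel_measurable (lebesgue_on \<Omega>) \<Longrightarrow> wmodular \<phi> \<omega> \<Omega> (\<lambda>x. ennreal \<bar>g x\<bar>) \<le> 1 \<Longrightarrow>
      AE x in lebesgue. x \<in> \<Omega> \<longrightarrow> phi_ext \<phi> x (ennreal c * maximal \<Omega> g x) \<le> ennreal K *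
       (epowr (maxop lebesgue (\<lambda>y. epowr (\<phi> y \<bar>g y\<bar> * indicator \<Omega> y) (1 / p)) x) p + ennreal (h x)
        + epowr (maxop lebesgue (\<lambda>y. epowr (ennreal (h y) * indicator \<Omega> y) (1 / p)) x) p)"
    by (rule maximal_pointwise_estimate[OF \<Omega> p A \<phi>]) blast
  define k where "k y = epowr (ennreal (h y) * indicator \<Omega> y) (1 / p)" for y
  have "(\<lambda>y. ennreal (h y)) \<in> borel_measurable (lebesgue_on \<Omega>)"
    using h(2) by measurable
  then have hm [measurable]: "(\<lambda>y. ennreal (h y) * indicator \<Omega> y) \<in> borel_measurable lebesgue"
    by (simp only: borel_measurable_restrict_space_iff_ennreal[OF \<Omega>s])
  have km [measurable]: "k \<in> borel_measurable lebesgue"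
    unfolding k_def[abs_def] by measurable
  obtain H where H: "0 \<le> H" "(\<integral>\<^sup>+ x. ennreal (h x) * indicator \<Omega> x * ennreal (\<omega> x) \<partial>lebesgue) = ennreal H"
  proof -
    have "(\<integral>\<^sup>+ x. ennreal (h x) * indicator \<Omega> x * ennreal (\<omega> x) \<partial>lebesgue)
        = (\<integral>\<^sup>+ x\<in>\<Omega>. ennreal (h x * \<omega> x) \<partial>lebesgue)"
      using h(1) w by (intro nn_integral_cong) (simp add: ennreal_mult is_weight_def mult_ac)
    then show ?thesis
      using h(3) that by (cases "\<integral>\<^sup>+ x\<in>\<Omega>. ennreal (h x * \<omega> x) \<partial>lebesgue") auto
  qed
  have "(\<integral>\<^sup>+ x. epowr (k x) p * ennreal (\<omega> x) \<partial>lebesgue) = ennreal H"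
    unfolding H(2)[symmetric] using p by (simp add: k_def epowr_epowr)
  then have maxk: "(\<integral>\<^sup>+ x. epowr (maxop lebesgue k x) p * ennreal (\<omega> x) \<partial>lebesgue) \<le> ennreal (K0 * H)"
    using K0(2)[OF km] K0(1) H(1) by (simp add: ennreal_mult)
  \<comment> \<open>Bounds the modular before scaling: \<open>K0\<close> belongs to
    \<open>u\<close>, \<open>H\<close> to \<open>h\<close>, and \<open>K0 * H\<close> to the maximal
    function of \<open>k\<close>.\<close>
  define L where "L = K * (K0 + H + K0 * H)"
  have L: "0 \<le> L" using K K0(1) H(1) by (simp add: L_def)
  \<comment> \<open>As \<open>e powr p \<le> e\<close>, dividing the argument by
    \<open>a * L\<close> brings the modular down to 1; the maximum with 1 keeps
    \<open>e \<le> 1\<close>, as \<open>phi_ext_scale\<close> requires.\<close>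
  define e where "e = 1 / max 1 (a * L)"
  have e: "0 < e" "e \<le> 1" by (auto simp: e_def)
  have eL: "a * e powr p * L \<le> 1"
  proof -
    have "e powr p \<le> e powr 1" using e p by (intro powr_mono') auto
    then have "e powr p * (a * L) \<le> e * (a * L)"
      using e ab L by (intro mult_right_mono) auto
    also have "\<dots> \<le> 1" by (simp add: e_def)
    finally show ?thesis by (simp add: mult_ac)
  qed
  show ?thesis
  proof (rule that[of "e * c"])
    show "0 < e * c" using e c by simp
    fix g :: "'a \<Rightarrow> real"
    assume g [measurable]: "g \<in> borel_measurable (lebesgue_on \<Omega>)"
      and mod: "wmodular \<phi> \<omega> \<Omega> (\<lambda>x. ennreal \<bar>g x\<bar>) \<le> 1"
    define u where "u y = epowr (\<phi> y \<bar>g y\<bar> * indicator \<Omega> y) (1 / p)" for y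
    have "(\<lambda>x. \<phi> x \<bar>g x\<bar>) \<in> borel_measurable (lebesgue_on \<Omega>)"
      using \<phi>(1) g unfolding Phi_w_def Phi_prefunction_def by blast
    then have [measurable]: "(\<lambda>x. \<phi> x \<bar>g x\<bar> * indicator \<Omega> x) \<in> borel_measurable lebesgue"
      by (simp only: borel_measurable_restrict_space_iff_ennreal[OF \<Omega>s])
    have um [measurable]: "u \<in> borel_measurable lebesgue"
      unfolding u_def[abs_def] by measurable
    have [measurable]: "maxop lebesgue u \<in> borel_measurable lebesgue" "maxop lebesgue k \<in> borel_measurable lebesgue"
      by (rule borel_measurable_maxop, simp)+
    have "(\<integral>\<^sup>+ x. epowr (u x) p * ennreal (\<omega> x) \<partial>lebesgue) = wmodular \<phi> \<omega> \<Omega> (\<lambda>x. ennreal \<bar>g x\<bar>)"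
      unfolding wmodular_def using p
      by (intro nn_integral_cong) (auto simp: u_def epowr_epowr phi_ext_def indicator_def)
    then have maxu: "(\<integral>\<^sup>+ x. epowr (maxop lebesgue u x) p * ennreal (\<omega> x) \<partial>lebesgue) \<le> ennreal K0"
      using K0(2)[OF um] mod mult_left_mono[OF mod, of "ennreal K0"] by (auto intro: order_trans)
    have "wmodular \<phi> \<omega> \<Omega> (\<lambda>x. ennreal (e * c) * maximal \<Omega> g x) \<le>
      (\<integral>\<^sup>+ x. ennreal (a * e powr p * K) * (epowr (maxop lebesgue u x) p * ennreal (\<omega> x)
        + ennreal (h x) * indicator \<Omega> x * ennreal (\<omega> x) + epowr (maxop lebesgue k x) p * ennreal (\<omega> x)) \<partial>lebesgue)"
      unfolding wmodular_def
    proof (rule nn_integral_mono_AE)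
      show "AE x in lebesgue. phi_ext \<phi> x (ennreal (e * c) * maximal \<Omega> g x) * ennreal (\<omega> x) * indicator \<Omega> x
        \<le> ennreal (a * e powr p * K) * (epowr (maxop lebesgue u x) p * ennreal (\<omega> x)
        + ennreal (h x) * indicator \<Omega> x * ennreal (\<omega> x) + epowr (maxop lebesgue k x) p * ennreal (\<omega> x))"
        using reg pt[OF g mod]
      proof eventually_elim
        case (elim x)
        show ?case
        proof (cases "x \<in> \<Omega>")
          case True
          let ?S = "epowr (maxop lebesgue u x) p + ennreal (h x) + epowr (maxop lebesgue k x) p"
          have "phi_ext \<phi> x (ennreal (e * c) * maximal \<Omega> g x)
              = phi_ext \<phi> x (ennreal e * (ennreal c * maximal \<Omega> g x))"
            using e c by (simp add: ennreal_mult mult.assoc)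
          also have "\<dots> \<le> ennreal (a * e powr p) * phi_ext \<phi> x (ennreal c * maximal \<Omega> g x)"
            using elim True by (intro phi_ext_scale[of p a b \<phi> x, OF p ab _ e]) simp
          also have "\<dots> \<le> ennreal (a * e powr p) * (ennreal K * ?S)"
            using elim True by (intro mult_left_mono) (auto simp: u_def[abs_def] k_def[abs_def])
          also have "\<dots> = ennreal (a * e powr p * K) * ?S"
            using ab K by (simp add: ennreal_mult mult.assoc)
          finally have "phi_ext \<phi> x (ennreal (e * c) * maximal \<Omega> g x) * ennreal (\<omega> x)
              \<le> ennreal (a * e powr p * K) * ?S * ennreal (\<omega> x)"
            by (rule mult_right_mono) simp
          with True show ?thesis by (simp add: distrib_right mult.assoc)
        qed simp
      qed
    qed
    also have "\<dots> = ennreal (a * e powr p * K) * ((\<integral>\<^sup>+ x. epowr (maxop lebesgue u x) p * ennreal (\<omega> x) \<partial>lebesgue)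
        + (\<integral>\<^sup>+ x. ennreal (h x) * indicator \<Omega> x * ennreal (\<omega> x) \<partial>lebesgue)
        + (\<integral>\<^sup>+ x. epowr (maxop lebesgue k x) p * ennreal (\<omega> x) \<partial>lebesgue))"
      by (simp add: nn_integral_cmult nn_integral_add)
    also have "\<dots> \<le> ennreal (a * e powr p * K) * (ennreal K0 + ennreal H + ennreal (K0 * H))"
      unfolding H(2) by (intro mult_left_mono add_mono maxu maxk) auto
    also have "\<dots> = ennreal (a * e powr p * L)"
      using ab K K0(1) H(1) by (simp add: L_def mult.assoc flip: ennreal_mult ennreal_plus)
    also have "\<dots> \<le> 1" using eL by simp
    finally show "wmodular \<phi> \<omega> \<Omega> (\<lambda>x. ennreal (e * c) * maximal \<Omega> g x) \<le> 1" .
  qed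
qed

lemma maximal_divide:
  assumes "open \<Omega>" "f \<in> borel_measurable (lebesgue_on \<Omega>)" "0 < l"
  shows "maximal \<Omega> (\<lambda>x. f x / l) x = maximal \<Omega> f x / ennreal l"
proof -
  have "\<Omega> \<inter> space lebesgue \<in> sets lebesgue" using assms(1) by simp
  moreover have "(\<lambda>y. ennreal \<bar>f y\<bar>) \<in> borel_measurable (lebesgue_on \<Omega>)"
    using assms(2) by measurable
  ultimately have m: "(\<lambda>y. ennreal \<bar>f y\<bar> * indicator \<Omega> y) \<in> borel_measurable lebesgue"
    by (simp only: borel_measurable_restrict_space_iff_ennreal)
  have "ennreal \<bar>f y / l\<bar> * indicator \<Omega> y = ennreal (1 / l) * (ennreal \<bar>f y\<bar> * indicator \<Omega> y)" for y
    using assms(3) by (simp add: mult.assoc[symmetric] flip: ennreal_mult)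
  then have "maximal \<Omega> (\<lambda>x. f x / l) x = ennreal (1 / l) * maximal \<Omega> f x"
    unfolding maximal_eq_maxop using maxop_cmult[OF refl m] by simp
  then show ?thesis
    using assms(3) by (simp add: divide_ennreal_def inverse_ennreal inverse_eq_divide mult.commute)
qed

theorem theorem4p3:
  fixes \<Omega> :: "'a::euclidean_space set"
    and p :: real
    and \<omega> :: "'a \<Rightarrow> real"
    and \<phi> :: "'a \<Rightarrow> real \<Rightarrow> ennreal"
  assumes "open \<Omega>"
    and "1 < p"
    and "Muckenhoupt p \<omega>"
    and "Phi_w \<Omega> \<phi>"
    and "A0 \<Omega> \<phi>"
    and "A1 \<omega> \<Omega> \<phi>"
    and "A2 \<omega> \<Omega> \<phi>"
    and "aInc p \<Omega> \<phi>"
  shows "\<exists>C::real. \<forall>f \<in> borel_measurable (lebesgue_on \<Omega>).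
           Lphi_norm \<phi> \<omega> \<Omega> (\<lambda>x. ennreal \<bar>f x\<bar>) < \<infinity> \<longrightarrow>
           Lphi_norm \<phi> \<omega> \<Omega> (maximal \<Omega> f) \<le> ennreal C * Lphi_norm \<phi> \<omega> \<Omega> (\<lambda>x. ennreal \<bar>f x\<bar>)"
proof -
  obtain c where c: "0 < c"
    and mod: "\<And>g. g \<in> borel_measurable (lebesgue_on \<Omega>) \<Longrightarrow> wmodular \<phi> \<omega> \<Omega> (\<lambda>x. ennreal \<bar>g x\<bar>) \<le> 1 \<Longrightarrow>
      wmodular \<phi> \<omega> \<Omega> (\<lambda>x. ennreal c * maximal \<Omega> g x) \<le> 1"
    by (rule wmodular_maximal_le_1[OF assms]) blast
  have "Lphi_norm \<phi> \<omega> \<Omega> (maximal \<Omega> f) \<le> ennreal (1 / c) * Lphi_norm \<phi> \<omega> \<Omega> (\<lambda>x. ennreal \<bar>f x\<bar>)"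
    if f [measurable]: "f \<in> borel_measurable (lebesgue_on \<Omega>)" for f
  proof -
    \<comment> \<open>For each \<open>l\<close> admissible for \<open>f\<close>, the modular bound
      for \<open>f / l\<close> and homogeneity make \<open>l / c\<close> admissible for
      \<open>maximal \<Omega> f\<close>. The factor \<open>c\<close> stays on the left so that the
      infimum over \<open>l\<close> can be taken on the right.\<close>
    have "ennreal c * Lphi_norm \<phi> \<omega> \<Omega> (maximal \<Omega> f) \<le> Lphi_norm \<phi> \<omega> \<Omega> (\<lambda>x. ennreal \<bar>f x\<bar>)"
      unfolding Lphi_norm_def[of _ _ _ "\<lambda>x. ennreal \<bar>f x\<bar>"]
    proof (rule Inf_greatest, clarify)
      fix l :: real assume l: "0 < l" "wmodular \<phi> \<omega> \<Omega> (\<lambda>x. ennreal \<bar>f x\<bar> / ennreal l) \<le> 1"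
      have "(\<lambda>x. ennreal \<bar>f x\<bar> / ennreal l) = (\<lambda>x. ennreal \<bar>f x / l\<bar>)"
        using l(1) by (simp add: divide_ennreal)
      with l(2) have "wmodular \<phi> \<omega> \<Omega> (\<lambda>x. ennreal c * maximal \<Omega> (\<lambda>x. f x / l) x) \<le> 1"
        by (intro mod) simp_all
      also have "(\<lambda>x. ennreal c * maximal \<Omega> (\<lambda>x. f x / l) x) = (\<lambda>x. maximal \<Omega> f x / ennreal (l / c))"
      proof
        fix x
        have "ennreal c * ennreal (1 / l) = ennreal (1 / (l / c))"
          using c l(1) by (simp flip: ennreal_mult)
        then show "ennreal c * maximal \<Omega> (\<lambda>x. f x / l) x = maximal \<Omega> f x / ennreal (l / c)"
          unfolding maximal_divide[OF assms(1) f l(1)] using c l(1)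
          by (simp add: divide_ennreal_def inverse_ennreal inverse_eq_divide
            mult.left_commute[of "ennreal c" "maximal \<Omega> f x"])
      qed
      finally have "Lphi_norm \<phi> \<omega> \<Omega> (maximal \<Omega> f) \<le> ennreal (l / c)"
        unfolding Lphi_norm_def using c l(1) by (intro Inf_lower) auto
      then have "ennreal c * Lphi_norm \<phi> \<omega> \<Omega> (maximal \<Omega> f) \<le> ennreal c * ennreal (l / c)"
        by (rule mult_left_mono) simp
      also have "\<dots> = ennreal l" using c l(1) by (simp flip: ennreal_mult)
      finally show "ennreal c * Lphi_norm \<phi> \<omega> \<Omega> (maximal \<Omega> f) \<le> ennreal l" .
    qed
    then have "ennreal (1 / c) * (ennreal c * Lphi_norm \<phi> \<omega> \<Omega> (maximal \<Omega> f))
        \<le> ennreal (1 / c) * Lphi_norm \<phi> \<omega> \<Omega> (\<lambda>x. ennreal \<bar>f x\<bar>)"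
      by (rule mult_left_mono) simp
    moreover have "ennreal (1 / c) * ennreal c = 1" using c by (simp flip: ennreal_mult)
    ultimately show ?thesis by (simp add: mult.assoc[symmetric])
  qed
  then show ?thesis by blast
qed

end
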